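(* In the group $\mathbb{Z}^\omega$, for every ordinal $\xi$ with $2\le \xi<\omega_1$ there exists a Haar null set $E\subseteq\mathbb{Z}^\omega$ that is the difference of two $\mathbf{\Pi}^0_\xi$ subsets of $\mathbb{Z}^\omega$ but is not contained in any $\mathbf{\Pi}^0_\xi$ Haar null subset of $\mathbb{Z}^\omega$.
   Context: $\mathbb{Z}^\omega$ is the (non-locally-compact abelian Polish) group of integer sequences under coordinatewise addition, with the product of discrete topologies. If $G$ is a Polish group, a set $A\subseteq G$ is called Haar null if there exist a Borel set $B\supseteq A$ and a Borel probability measure $\mu$ on $G$ such that $\mu(gBh)=0$ for every $g,h\in G$. $\mathbf{\Pi}^0_\xi$ denotes the corresponding multiplicative class of the Borel hierarchy (e.g. $\mathbf{\Pi}^0_2$ = $G_\delta$). *)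

theory Defs
  imports "HOL-Analysis.Analysis" "HOL-Probability.Probability"
begin

text \<open>The group Z^omega: integer sequences, with the product topology of the
  discrete topologies (Function_Topology instance on nat => int; int carries
  its discrete metric topology). The group operation is coordinatewise addition.\<close>
type_synonym zomega = "nat \<Rightarrow> int"

text \<open>Countable ordinals are represented by well-orders on subsets of nat.
  For a well-order r and a point a, pi0_below r a is the class
  Pi^0_(1+zeta) where zeta is the order type of the strict initial segment
  underS r a:  Pi^0_1 = closed sets, and for zeta >= 1,
  Pi^0_(1+zeta) = complements of countable unions of sets from
  the classes Pi^0_(1+eta), eta < zeta.\<close>
inductive pi0_below :: "'i rel \<Rightarrow> 'i \<Rightarrow> 'a::topological_space set \<Rightarrow> bool"
  for r :: "'i rel" where
  base: "underS r a = {} \<Longrightarrow> closed A \<Longrightarrow> pi0_below r a A"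
| step: "underS r a \<noteq> {} \<Longrightarrow> (\<And>n::nat. \<exists>b\<in>underS r a. pi0_below r b (F n))
          \<Longrightarrow> pi0_below r a (- (\<Union>n. F n))"

text \<open>For a nonempty well-order r of order type zeta >= 1, Pi0 r is the class
  Pi^0_(1+zeta): complements of countable unions of sets lying in classes
  Pi^0_(1+eta) with eta < zeta (the eta < zeta being the order types of
  initial segments underS r b, b in Field r).\<close>
definition Pi0 :: "'i rel \<Rightarrow> 'a::topological_space set \<Rightarrow> bool" where
  "Pi0 r A \<longleftrightarrow> (\<exists>F::nat \<Rightarrow> 'a set. (\<forall>n. \<exists>b\<in>Field r. pi0_below r b (F n)) \<and> A = - (\<Union>n. F n))"

definition haar_null :: "zomega set \<Rightarrow> bool" where
  "haar_null A \<longleftrightarrow> (\<exists>B \<mu>. B \<in> sets (borel :: zomega measure) \<and> A \<subseteq> B \<and>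
     prob_space \<mu> \<and> sets \<mu> = sets (borel :: zomega measure) \<and>
     (\<forall>g h :: zomega. measure \<mu> ((\<lambda>x i. g i + x i + h i) ` B) = 0))"

end

theory Submission
  imports Defs
begin

text \<open>For \<open>\<alpha> \<in> \<omega>\<^sup>\<omega>\<close> let \<open>\<rho>\<^sub>\<alpha>\<close> be the uniform measure on the box \<open>\<Prod>i. [4^\<alpha>\<^sub>i, 4^\<alpha>\<^sub>i + 2^\<alpha>\<^sub>i)\<close>.
  A point of such a box determines \<open>\<alpha>\<close>, and points of different boxes differ by at least 2 in some
  coordinate, so a set with at most one point in each box meets every translate of \<open>{0, 1}\<^sup>\<omega>\<close> in at
  most one point and is Haar null.  On the other hand, if \<open>C\<close> is Haar null then, by Fubini and
  because boxes with long sides are almost invariant under a bounded translation,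
  \<open>\<rho>\<^sub>\<alpha>(C) < 1\<close> whenever \<open>\<alpha>\<close> grows fast enough; there is room left for \<open>\<alpha>\<close> to code an
  arbitrary \<open>\<Pi>\<^sup>0\<^sub>\<xi>\<close> set \<open>C\<^sub>\<alpha>\<close>.  The set \<open>E\<close> consists of one point outside \<open>C\<^sub>\<alpha>\<close> in the box of each
  \<open>\<alpha>\<close> with \<open>\<rho>\<^sub>\<alpha>(C\<^sub>\<alpha>) < 1\<close>, hence it is not contained in a \<open>\<Pi>\<^sup>0\<^sub>\<xi>\<close> Haar null set.  To choose
  the point in a definable way, unfold the complement of \<open>C\<^sub>\<alpha>\<close> into a Souslin scheme and walk
  through it, always keeping positive measure; ``measure at least \<open>q\<close>'' does not leave the class of
  a set, so that the choice of each digit is \<open>\<Delta>\<^sup>0\<^sub>\<xi>\<close>, and being the chosen point is \<open>\<Pi>\<^sup>0\<^sub>\<xi>\<close>.\<close>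

section \<open>Closure properties of the classes\<close>

text \<open>With \<open>L = Field r\<close> this is \<open>Pi0 r\<close>, and with
  \<open>L = underS r a\<close> it is \<open>pi0_below r a\<close> at a non-minimal
  \<open>a\<close>. Intersections and unions are treated once for \<open>pi0_over\<close> and then
  transferred.\<close>

definition pi0_over :: "'i rel \<Rightarrow> 'i set \<Rightarrow> 'a::topological_space set \<Rightarrow> bool" where
  "pi0_over r L A \<longleftrightarrow> (\<exists>F::nat \<Rightarrow> 'a set. (\<forall>n. \<exists>b\<in>L. pi0_below r b (F n)) \<and> A = - (\<Union>n. F n))"

lemma Pi0_eq_over: "Pi0 r = pi0_over r (Field r)"
  by (simp add: fun_eq_iff Pi0_def pi0_over_def)

lemma pi0_below_min_iff: "underS r a = {} \<Longrightarrow> pi0_below r a A \<longleftrightarrow> closed A"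
  by (auto intro: pi0_below.base elim: pi0_below.cases)

lemma pi0_below_eq_over:
  assumes "underS r a \<noteq> {}"
  shows "pi0_below r a = (pi0_over r (underS r a) :: 'a::topological_space set \<Rightarrow> bool)"
proof (rule ext)
  fix A
  show "pi0_below r a A = pi0_over r (underS r a) A"
  proof
    assume "pi0_below r a A"
    then show "pi0_over r (underS r a) A"
      by cases (use assms in \<open>auto simp: pi0_over_def\<close>)
  next
    assume "pi0_over r (underS r a) A"
    then obtain F where "\<forall>n::nat. \<exists>b\<in>underS r a. pi0_below r b (F n)" and A: "A = - (\<Union>n. F n)"
      unfolding pi0_over_def by blast
    then show "pi0_below r a A"
      unfolding A by (intro pi0_below.step[OF assms]) blast
  qed
qed

lemma underS_induct [consumes 1, case_names less]:
  assumes "Well_order r" and "\<And>a. (\<And>b. b \<in> underS r a \<Longrightarrow> P b) \<Longrightarrow> P a"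
  shows "P a"
proof -
  have "wf (r - Id)"
    using assms(1) by (simp add: well_order_on_def)
  then show ?thesis
  proof (induction a rule: wf_induct_rule)
    case (less a)
    show ?case
      by (rule assms(2), rule less) (simp add: underS_def)
  qed
qed

lemma underS_trans:
  assumes "Well_order r" "b \<in> underS r a" "c \<in> underS r b"
  shows "c \<in> underS r a"
proof -
  have "trans r" "antisym r"
    using assms(1) by (auto simp: order_on_defs)
  then show ?thesis
    using assms(2,3) unfolding underS_def by (auto dest: transD antisymD)
qed

lemma underS_total:
  assumes "Well_order r" "a \<in> Field r" "b \<in> Field r"
  shows "a = b \<or> a \<in> underS r b \<or> b \<in> underS r a"
proof -
  have "Total r"
    using assms(1) by (auto simp: order_on_defs)
  then show ?thesis
    using assms(2,3) unfolding underS_def total_on_def by auto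
qed

text \<open>Needed because \<open>nat\<close> and \<open>int\<close> are not instances of \<open>metric_space\<close>: zero-dimensionality
  replaces metrizability in showing that open sets are \<open>F\<^sub>\<sigma>\<close>.\<close>

class zero_dimensional_space = topological_space +
  assumes clopen_neighbourhood:
    "open U \<Longrightarrow> x \<in> U \<Longrightarrow> \<exists>V. open V \<and> closed V \<and> x \<in> V \<and> V \<subseteq> U"

instance discrete_topology < zero_dimensional_space
proof
  fix U :: "'a set" and x
  assume "x \<in> U"
  then show "\<exists>V. open V \<and> closed V \<and> x \<in> V \<and> V \<subseteq> U"
    by (intro exI[of _ U]) (simp add: closed_def Topological_Spaces.open_discrete)
qed

instance prod :: (zero_dimensional_space, zero_dimensional_space) zero_dimensional_space
proof
  fix U :: "('a \<times> 'b) set" and x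
  assume "open U" "x \<in> U"
  then obtain A B where AB: "open A" "open B" "x \<in> A \<times> B" "A \<times> B \<subseteq> U"
    by (rule open_prod_elim)
  have "fst x \<in> A" "snd x \<in> B"
    using AB(3) by auto
  obtain A' where "open A'" "closed A'" "fst x \<in> A'" "A' \<subseteq> A"
    using clopen_neighbourhood[OF AB(1) \<open>fst x \<in> A\<close>] by blast
  moreover obtain B' where "open B'" "closed B'" "snd x \<in> B'" "B' \<subseteq> B"
    using clopen_neighbourhood[OF AB(2) \<open>snd x \<in> B\<close>] by blast
  ultimately show "\<exists>V. open V \<and> closed V \<and> x \<in> V \<and> V \<subseteq> U"
    using AB(4) by (intro exI[of _ "A' \<times> B'"]) (auto simp: open_Times closed_Times mem_Times_iff)
qed

instance "fun" :: (type, zero_dimensional_space) zero_dimensional_space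
proof
  fix U :: "('a \<Rightarrow> 'b) set" and x
  assume "open U" and x: "x \<in> U"
  then have "openin (product_topology (\<lambda>i. euclidean) UNIV) U"
    by (simp add: euclidean_product_topology)
  from product_topology_open_contains_basis[OF this x] obtain X where
    X: "x \<in> Pi\<^sub>E UNIV X" "\<forall>i. openin euclidean (X i)"
      "finite {i. X i \<noteq> topspace (euclidean :: 'b topology)}" "Pi\<^sub>E UNIV X \<subseteq> U"
    by (elim exE conjE) rule
  \<comment> \<open>Only these finitely many coordinates are constrained by the basic box, so
    \<open>W\<close> is a finite intersection and stays open.\<close>
  define I where "I = {i. X i \<noteq> UNIV}"
  have "finite I"
    using X(3) by (simp add: I_def)
  have "\<exists>V. open V \<and> closed V \<and> x i \<in> V \<and> V \<subseteq> X i" for i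
  proof (rule clopen_neighbourhood)
    show "open (X i)"
      using X(2) by (simp only: open_openin)
    show "x i \<in> X i"
      using X(1) by (rule PiE_mem) simp
  qed
  from choice[OF allI[OF this]]
  obtain V where V: "\<forall>i. open (V i) \<and> closed (V i) \<and> x i \<in> V i \<and> V i \<subseteq> X i" ..
  define W where "W = (\<Inter>i\<in>I. (\<lambda>z. z i) -` V i)"
  have cont: "continuous_on UNIV (\<lambda>z::'a \<Rightarrow> 'b. z i)" for i
    by (rule continuous_on_product_then_coordinatewise[OF continuous_on_id])
  have "open W"
    unfolding W_def by (intro open_INT \<open>finite I\<close> ballI open_vimage cont) (simp add: V)
  moreover have "closed W"
    unfolding W_def by (intro closed_INT ballI closed_vimage cont) (simp add: V)
  moreover have "x \<in> W"
    unfolding W_def using V by simp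
  moreover have "W \<subseteq> Pi\<^sub>E UNIV X"
  proof
    fix z assume z: "z \<in> W"
    have "z i \<in> X i" for i
    proof (cases "i \<in> I")
      case True
      then show ?thesis
        using z V unfolding W_def by blast
    qed (simp add: I_def)
    then show "z \<in> Pi\<^sub>E UNIV X"
      by (simp add: PiE_iff)
  qed
  ultimately show "\<exists>V. open V \<and> closed V \<and> x \<in> V \<and> V \<subseteq> U"
    using X(4) by (intro exI[of _ W]) simp
qed

instance int :: second_countable_topology
proof
  show "\<exists>B::int set set. countable B \<and> open = generate_topology B"
  proof (intro exI[of _ "range (\<lambda>n. {n})"] conjI ext iffI)
    fix U :: "int set"
    have "generate_topology (range (\<lambda>n. {n})) (\<Union>n\<in>U. {n})"
      by (intro generate_topology.UN) (auto intro: generate_topology.Basis)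
    then show "generate_topology (range (\<lambda>n. {n})) U"
      by simp
  qed (auto simp: Topological_Spaces.open_discrete)
qed

text \<open>The clopen subsets of \<open>U\<close> cover it, and by Lindelof countably many of them
  already do.\<close>

lemma open_Union_closed:
  fixes U :: "'a::{second_countable_topology, zero_dimensional_space} set"
  assumes "open U"
  obtains G where "\<And>n::nat. closed (G n)" "U = (\<Union>n. G n)"
proof -
  let ?C = "{V. open V \<and> closed V \<and> V \<subseteq> U}"
  obtain D where D: "D \<subseteq> ?C" "countable D" "\<Union>D = \<Union>?C"
    by (rule Lindelof[of ?C]) auto
  \<comment> \<open>The empty set is added so that the family can be enumerated by
    \<open>nat\<close> even when \<open>D\<close> is empty.\<close>
  have U: "U = \<Union>(insert {} D)"
  proof
    show "U \<subseteq> \<Union>(insert {} D)"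
      unfolding Union_insert D(3) using clopen_neighbourhood[OF assms] by fast
  qed (use D(1) in auto)
  define G where "G = from_nat_into (insert {} D)"
  have range_G: "range G = insert {} D"
    unfolding G_def by (intro range_from_nat_into) (use D(2) in auto)
  have "closed (G n)" for n
  proof -
    have "G n \<in> insert {} D"
      using range_G by blast
    then show ?thesis
      using D(1) by auto
  qed
  moreover have "U = (\<Union>n. G n)"
    unfolding range_G by (rule U)
  ultimately show ?thesis
    by (rule that)
qed

section \<open>Monotonicity, Boolean operations and continuous preimages\<close>

context
  fixes r :: "'i rel"
  assumes wo: "Well_order r"
begin

text \<open>By induction on the level: the open complement is a countable union of closed sets, and
  these already lie in the lower classes.\<close>

lemma closed_imp_pi0_below:
  fixes A :: "'a::{second_countable_topology, zero_dimensional_space} set"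
  assumes "closed A"
  shows "pi0_below r a A"
  using wo assms
proof (induction a arbitrary: A rule: underS_induct)
  case (less a)
  show ?case
  proof (cases "underS r a = {}")
    case True
    then show ?thesis
      using less.prems by (rule pi0_below.base)
  next
    case False
    then obtain b where b: "b \<in> underS r a" by auto
    obtain G where G: "\<And>n::nat. closed (G n)" "- A = (\<Union>n. G n)"
      using open_Union_closed[of "- A"] less.prems by (auto simp: closed_def)
    then have "A = - (\<Union>n. G n)" by auto
    then show ?thesis
      using pi0_below.step[OF False, of G] b less.IH[OF b G(1)] by auto
  qed
qed

text \<open>\<open>insert b\<close> covers two cases at once. At the minimal level the complement is
  a countable union of closed sets, which have level \<open>b\<close> itself; above it the pieces
  have strictly smaller level.\<close>

lemma pi0_below_Compl:
  fixes A :: "'a::{second_countable_topology, zero_dimensional_space} set"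
  assumes "pi0_below r b A"
  shows "\<exists>G::nat \<Rightarrow> 'a set. (\<forall>n. \<exists>c\<in>insert b (underS r b). pi0_below r c (G n)) \<and> A = - (\<Union>n. G n)"
proof (cases "underS r b = {}")
  case True
  then have "closed A"
    using assms by (simp add: pi0_below_min_iff)
  then obtain G where G: "\<And>n::nat. closed (G n)" "- A = (\<Union>n. G n)"
    using open_Union_closed[of "- A"] by (auto simp: closed_def)
  then have "A = - (\<Union>n. G n)" by auto
  moreover have "\<forall>n. \<exists>c\<in>insert b (underS r b). pi0_below r c (G n)"
    using closed_imp_pi0_below[OF G(1)] by blast
  ultimately show ?thesis
    by (intro exI[of _ G] conjI)
next
  case False
  obtain G where G: "(\<forall>n::nat. \<exists>c\<in>underS r b. pi0_below r c (G n)) \<and> A = - (\<Union>n. G n)"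
    using assms unfolding pi0_below_eq_over[OF False] pi0_over_def ..
  then have "\<forall>n. \<exists>c\<in>insert b (underS r b). pi0_below r c (G n)"
    by blast
  then show ?thesis
    using G by (intro exI[of _ G] conjI) simp_all
qed

lemma pi0_below_imp_over:
  fixes A :: "'a::{second_countable_topology, zero_dimensional_space} set"
  assumes "pi0_below r b A" "b \<in> L" "underS r b \<subseteq> L"
  shows "pi0_over r L A"
proof -
  obtain G where G: "(\<forall>n::nat. \<exists>c\<in>insert b (underS r b). pi0_below r c (G n)) \<and> A = - (\<Union>n. G n)"
    using pi0_below_Compl[OF assms(1)] ..
  have "insert b (underS r b) \<subseteq> L"
    using assms(2,3) by simp
  then have "\<forall>n. \<exists>c\<in>L. pi0_below r c (G n)"
    using G by blast
  then show ?thesis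
    using G unfolding pi0_over_def by (intro exI[of _ G] conjI) simp_all
qed

lemma pi0_below_mono:
  fixes A :: "'a::{second_countable_topology, zero_dimensional_space} set"
  assumes "pi0_below r b A" "b \<in> underS r a"
  shows "pi0_below r a A"
proof -
  have "underS r a \<noteq> {}" "underS r b \<subseteq> underS r a"
    using assms(2) by (blast, blast intro: underS_trans[OF wo])
  then show ?thesis
    using pi0_below_imp_over[OF assms] by (subst pi0_below_eq_over)
qed

lemma pi0_over_Compl_below: "pi0_below r b A \<Longrightarrow> b \<in> L \<Longrightarrow> pi0_over r L (- A)"
  unfolding pi0_over_def by (rule exI[of _ "\<lambda>_. A"]) auto

text \<open>A countable family of countable unions is merged through pairs. The index type is kept
  general: \<open>bool\<close> yields binary intersections, and pairs of a number and a list of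
  digits occur in the selection.\<close>

lemma pi0_over_INT:
  fixes A :: "'n::countable \<Rightarrow> 'a::topological_space set"
  assumes "\<And>n. pi0_over r L (A n)"
  shows "pi0_over r L (\<Inter>n. A n)"
proof -
  from assms have "\<forall>n. \<exists>F. (\<forall>m. \<exists>b\<in>L. pi0_below r b (F m)) \<and> A n = - (\<Union>m::nat. F m)"
    unfolding pi0_over_def by blast
  from choice[OF this] obtain F
    where F: "\<And>n m. \<exists>b\<in>L. pi0_below r b (F n m)" and A: "\<And>n. A n = - (\<Union>m::nat. F n m)"
    by blast
  define G where "G k = (case from_nat k of (n, m) \<Rightarrow> F n m)" for k
  have G: "G (to_nat (n, m)) = F n m" for n m
    by (simp add: G_def)
  have "(\<Inter>n. A n) = - (\<Union>k. G k)"
  proof (intro set_eqI iffI)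
    fix x assume "x \<in> - (\<Union>k. G k)"
    then have "x \<notin> F n m" for n m
      using G[of n m] by blast
    then show "x \<in> (\<Inter>n. A n)"
      by (simp add: A)
  qed (auto simp: A G_def split: prod.splits)
  moreover have "\<forall>k. \<exists>b\<in>L. pi0_below r b (G k)"
    using F by (simp add: G_def split: prod.split)
  ultimately show ?thesis
    unfolding pi0_over_def by (intro exI[of _ G] conjI)
qed

lemma pi0_below_INT:
  fixes A :: "'n::countable \<Rightarrow> 'a::topological_space set"
  assumes "\<And>n. pi0_below r a (A n)"
  shows "pi0_below r a (\<Inter>n. A n)"
proof (cases "underS r a = {}")
  case True
  then show ?thesis
    using assms by (auto simp: pi0_below_min_iff)
next
  case False
  then show ?thesis
    using assms pi0_over_INT[of "underS r a" A] by (simp add: pi0_below_eq_over)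
qed

lemma INT_bool: "(\<Inter>b. if b then A else B) = A \<inter> B"
  by (auto split: if_splits)

lemma pi0_over_Int: "pi0_over r L A \<Longrightarrow> pi0_over r L B \<Longrightarrow> pi0_over r L (A \<inter> B)"
  using pi0_over_INT[of L "\<lambda>b. if b then A else B"] by (simp only: INT_bool split: if_split) simp

lemma pi0_below_Int: "pi0_below r a A \<Longrightarrow> pi0_below r a B \<Longrightarrow> pi0_below r a (A \<inter> B)"
  using pi0_below_INT[of a "\<lambda>b. if b then A else B"] by (simp only: INT_bool split: if_split) simp

lemma pi0_below_max:
  fixes A B :: "'a::{second_countable_topology, zero_dimensional_space} set"
  assumes "b \<in> L" "c \<in> L" "L \<subseteq> Field r" "pi0_below r b A" "pi0_below r c B"
  obtains d where "d \<in> L" "pi0_below r d A" "pi0_below r d B"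
proof -
  have "b \<in> Field r" "c \<in> Field r"
    using assms(1-3) by auto
  then consider "b = c" | "b \<in> underS r c" | "c \<in> underS r b"
    using underS_total[OF wo] by blast
  then show ?thesis
    by cases (use assms that pi0_below_mono in \<open>blast+\<close>)
qed

text \<open>A union of two intersections is an intersection over pairs of the sets
  \<open>- (F m \<inter> G n)\<close>. Both sets are first raised to the larger of their two levels,
  which is closed under intersection.\<close>

lemma pi0_over_Un:
  fixes A B :: "'a::{second_countable_topology, zero_dimensional_space} set"
  assumes "L \<subseteq> Field r" "pi0_over r L A" "pi0_over r L B"
  shows "pi0_over r L (A \<union> B)"
proof -
  obtain F where F: "\<And>m::nat. \<exists>b\<in>L. pi0_below r b (F m)" "A = - (\<Union>m. F m)"
    using assms(2) unfolding pi0_over_def by metis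
  obtain G where G: "\<And>m::nat. \<exists>b\<in>L. pi0_below r b (G m)" "B = - (\<Union>m. G m)"
    using assms(3) unfolding pi0_over_def by metis
  have *: "\<exists>b\<in>L. pi0_below r b (F m \<inter> G n)" for m n
  proof -
    obtain b c where "b \<in> L" "c \<in> L" "pi0_below r b (F m)" "pi0_below r c (G n)"
      using F(1)[of m] G(1)[of n] by blast
    then obtain d where "d \<in> L" "pi0_below r d (F m)" "pi0_below r d (G n)"
      using pi0_below_max[OF _ _ assms(1)] by blast
    then show ?thesis
      using pi0_below_Int by blast
  qed
  have "A \<union> B = (\<Inter>p. case p of (m, n) \<Rightarrow> - (F m \<inter> G n))"
    using F(2) G(2) by auto
  moreover have "pi0_over r L (case p of (m, n) \<Rightarrow> - (F m \<inter> G n))" for p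
    using * pi0_over_Compl_below by (metis case_prod_conv surj_pair)
  ultimately show ?thesis
    using pi0_over_INT[of L "\<lambda>p. case p of (m, n) \<Rightarrow> - (F m \<inter> G n)"] by simp
qed

lemma pi0_below_Un:
  fixes A B :: "'a::{second_countable_topology, zero_dimensional_space} set"
  assumes "pi0_below r a A" "pi0_below r a B"
  shows "pi0_below r a (A \<union> B)"
  using assms pi0_over_Un[OF Order_Relation.underS_Field[of r a], of A B]
  by (cases "underS r a = {}") (auto simp: pi0_below_min_iff pi0_below_eq_over)

lemma pi0_over_finite_UN:
  fixes A :: "'n \<Rightarrow> 'a::{second_countable_topology, zero_dimensional_space} set"
  assumes "finite I" "L \<subseteq> Field r" "b \<in> L" "\<forall>i\<in>I. pi0_over r L (A i)"
  shows "pi0_over r L (\<Union>i\<in>I. A i)"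
  using assms(1,4)
proof (induction I rule: finite_induct)
  case empty
  have "pi0_over r L (- UNIV :: 'a set)"
    by (rule pi0_over_Compl_below[OF closed_imp_pi0_below[OF closed_UNIV] assms(3)])
  then show ?case
    by simp
next
  case (insert i I)
  then have "pi0_over r L (A i)" "pi0_over r L (\<Union>i\<in>I. A i)"
    by blast+
  from pi0_over_Un[OF assms(2) this] show ?case
    by (simp only: UN_insert)
qed

lemma pi0_below_vimage:
  assumes "pi0_below r a A" "continuous_on UNIV f"
  shows "pi0_below r a (f -` A)"
  using assms(1)
proof induction
  case (base a A)
  then show ?case
    using assms(2) by (intro pi0_below.base) (auto intro: closed_vimage)
next
  case (step a F)
  then have "pi0_below r a (- (\<Union>n. f -` F n))"
    by (intro pi0_below.step) auto
  moreover have "f -` (- (\<Union>n. F n)) = - (\<Union>n. f -` F n)"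
    by auto
  ultimately show ?case
    by simp
qed

lemma pi0_over_vimage:
  assumes "pi0_over r L A" "continuous_on UNIV f"
  shows "pi0_over r L (f -` A)"
proof -
  obtain F where F: "\<And>m::nat. \<exists>b\<in>L. pi0_below r b (F m)" and A: "A = - (\<Union>m. F m)"
    using assms(1) unfolding pi0_over_def by blast
  have "\<forall>m. \<exists>b\<in>L. pi0_below r b (f -` F m)"
    using F pi0_below_vimage[OF _ assms(2)] by meson
  moreover have "f -` A = - (\<Union>m. f -` F m)"
    unfolding A by auto
  ultimately show ?thesis
    unfolding pi0_over_def by (intro exI[of _ "\<lambda>m. f -` F m"] conjI)
qed

lemma pi0_below_borel:
  assumes "pi0_below r a A"
  shows "A \<in> sets borel"
  using assms
proof induction
  case (step a F)
  then have "F n \<in> sets borel" for n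
    by blast
  then show ?case
    by (intro borel_comp sets.countable_UN) auto
qed auto

lemma pi0_over_borel:
  assumes "pi0_over r L A"
  shows "A \<in> sets borel"
proof -
  obtain F where F: "\<And>m::nat. \<exists>b\<in>L. pi0_below r b (F m)" and A: "A = - (\<Union>m. F m)"
    using assms(1) unfolding pi0_over_def by blast
  have "F n \<in> sets borel" for n
    using F[of n] pi0_below_borel by blast
  then show ?thesis
    unfolding A by (intro borel_comp sets.countable_UN) auto
qed

end

section \<open>Souslin schemes\<close>

definition cylinder :: "nat \<Rightarrow> (nat \<Rightarrow> 'a) \<Rightarrow> (nat \<Rightarrow> 'a) set" where
  "cylinder k y = {z. \<forall>i<k. z i = y i}"

lemma self_in_cylinder [simp]: "y \<in> cylinder k y"
  by (simp add: cylinder_def)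

lemma cylinder_mono: "k \<le> l \<Longrightarrow> cylinder l y \<subseteq> cylinder k y"
  by (auto simp: cylinder_def)

lemma continuous_on_coord: "continuous_on S f \<Longrightarrow> continuous_on S (\<lambda>x. f x i)"
  by (rule continuous_on_product_then_coordinatewise)

lemma continuous_on_compose_discrete:
  fixes g :: "'a::discrete_topology \<Rightarrow> 'b::topological_space"
  assumes "continuous_on S f"
  shows "continuous_on S (\<lambda>x. g (f x))"
proof (rule continuous_on_compose2[OF _ assms, of UNIV g])
  show "continuous_on UNIV g"
    by (simp add: continuous_on_open_vimage Topological_Spaces.open_discrete)
qed simp

lemma open_cylinder: "open (cylinder k (y :: nat \<Rightarrow> 'a::discrete_topology))"
proof -
  have "cylinder k y = (\<Inter>i\<in>{..<k}. (\<lambda>z. z i) -` {y i})"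
    by (auto simp: cylinder_def)
  then show ?thesis
    by (auto intro!: open_INT open_vimage continuous_on_coord continuous_on_id simp: Topological_Spaces.open_discrete)
qed

lemma open_finitely_determined:
  fixes S :: "(nat \<Rightarrow> 'a::discrete_topology) set"
  assumes "\<And>y z. y \<in> S \<Longrightarrow> z \<in> cylinder k y \<Longrightarrow> z \<in> S"
  shows "open S"
proof -
  have "S = (\<Union>y\<in>S. cylinder k y)"
    using assms by auto
  then show ?thesis
    by (metis open_UN open_cylinder)
qed

lemma open_contains_cylinder:
  fixes y :: "nat \<Rightarrow> 'a::topological_space"
  assumes "open U" "y \<in> U"
  obtains k where "cylinder k y \<subseteq> U"
proof -
  have "openin (product_topology (\<lambda>i. euclidean) UNIV) U"
    using assms(1) by (simp add: euclidean_product_topology)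
  from product_topology_open_contains_basis[OF this assms(2)] obtain X where
    X: "y \<in> Pi\<^sub>E UNIV X" "\<forall>i. openin euclidean (X i)"
      "finite {i. X i \<noteq> topspace (euclidean :: 'a topology)}" "Pi\<^sub>E UNIV X \<subseteq> U"
    by (elim exE conjE) rule
  have "finite {i. X i \<noteq> UNIV}"
    using X(3) by simp
  then obtain k where "\<forall>i\<in>{i. X i \<noteq> UNIV}. i < k"
    unfolding finite_nat_set_iff_bounded ..
  then have k: "i < k" if "X i \<noteq> UNIV" for i
    using that by simp
  have "cylinder k y \<subseteq> Pi\<^sub>E UNIV X"
  proof
    fix z assume z: "z \<in> cylinder k y"
    have "z i \<in> X i" for i
    proof (cases "X i = UNIV")
      case False
      then have "z i = y i"
        using z k by (simp add: cylinder_def)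
      then show ?thesis
        using X(1) by (simp add: PiE_iff)
    qed simp
    then show "z \<in> Pi\<^sub>E UNIV X"
      by (simp add: PiE_iff)
  qed
  then show ?thesis
    using X(4) by (intro that[of k]) simp
qed

text \<open>If \<open>(a, y)\<close> were outside \<open>W\<close>, an open product neighbourhood
  would miss \<open>W\<close>, and it contains a product of two cylinders of a common length.
  Membership in a closed set thus reduces to finite information.\<close>

lemma closed_prod_cylinderD:
  fixes W :: "((nat \<Rightarrow> 'a::topological_space) \<times> (nat \<Rightarrow> 'b::topological_space)) set"
  assumes "closed W" "\<And>k. \<exists>a'\<in>cylinder k a. \<exists>y'\<in>cylinder k y. (a', y') \<in> W"
  shows "(a, y) \<in> W"
proof (rule ccontr)
  assume "(a, y) \<notin> W"
  then have "(a, y) \<in> - W" "open (- W)"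
    using assms(1) by auto
  from open_prod_elim[OF this(2,1)] obtain A B
    where AB: "open A" "open B" "a \<in> A" "y \<in> B" "A \<times> B \<subseteq> - W"
    unfolding mem_Sigma_iff by metis
  obtain k where k: "cylinder k a \<subseteq> A"
    using open_contains_cylinder[OF AB(1,3)] .
  obtain l where l: "cylinder l y \<subseteq> B"
    using open_contains_cylinder[OF AB(2,4)] .
  have "cylinder (max k l) a \<subseteq> A" "cylinder (max k l) y \<subseteq> B"
    using k l cylinder_mono[of k "max k l" a] cylinder_mono[of l "max k l" y] by auto
  then show False
    using assms(2)[of "max k l"] AB(5) by blast
qed

text \<open>A branch \<open>d\<close> is a witness for membership in \<open>W\<close>: relative to it, membership becomes a
  condition on the finite initial segments of a point, as for closed sets.\<close>

definition souslin_scheme ::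
  "'i rel \<Rightarrow> 'i \<Rightarrow> ('p::topological_space \<times> (nat \<Rightarrow> 'b::topological_space)) set
    \<Rightarrow> (nat \<Rightarrow> (nat \<Rightarrow> nat) \<Rightarrow> ('p \<times> (nat \<Rightarrow> 'b)) set) \<Rightarrow> bool" where
  "souslin_scheme r a W R \<longleftrightarrow>
     (\<forall>d. W \<subseteq> R 0 d) \<and>
     (\<forall>k d d'. d' \<in> cylinder k d \<longrightarrow> R k d' = R k d) \<and>
     (\<forall>k d. R k d \<subseteq> (\<Union>m. R (Suc k) (d(k := m)))) \<and>
     (\<forall>k d. pi0_below r a (R k d)) \<and>
     (\<forall>\<alpha> y d. (\<forall>k. \<exists>z\<in>cylinder k y. (\<alpha>, z) \<in> R k d) \<longrightarrow> (\<alpha>, y) \<in> W)"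

lemma souslin_schemeD:
  assumes "souslin_scheme r a W R"
  shows "W \<subseteq> R 0 d" "d' \<in> cylinder k d \<Longrightarrow> R k d' = R k d"
    "x \<in> R k d \<Longrightarrow> \<exists>m. x \<in> R (Suc k) (d(k := m))" "pi0_below r a (R k d)"
    "(\<And>k. \<exists>z\<in>cylinder k y. (\<alpha>, z) \<in> R k d) \<Longrightarrow> (\<alpha>, y) \<in> W"
proof -
  note * = assms[unfolded souslin_scheme_def]
  show "W \<subseteq> R 0 d" "d' \<in> cylinder k d \<Longrightarrow> R k d' = R k d" "pi0_below r a (R k d)"
    using * by (elim conjE, simp)+
  show "\<exists>m. x \<in> R (Suc k) (d(k := m))" if "x \<in> R k d"
  proof -
    have "R k d \<subseteq> (\<Union>m. R (Suc k) (d(k := m)))"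
      using * by (elim conjE, simp)
    then show ?thesis
      using that by blast
  qed
  show "(\<alpha>, y) \<in> W" if "\<And>k. \<exists>z\<in>cylinder k y. (\<alpha>, z) \<in> R k d"
  proof -
    have "\<forall>\<alpha> y d. (\<forall>k. \<exists>z\<in>cylinder k y. (\<alpha>, z) \<in> R k d) \<longrightarrow> (\<alpha>, y) \<in> W"
      using * by (elim conjE)
    then show ?thesis
      using that by blast
  qed
qed

text \<open>For \<open>W = (\<Inter>n. \<Union>m. G n m)\<close> the digit at position \<open>k\<close> codes a list giving, for each
  \<open>n < k\<close>, the next digit of the scheme already chosen for the \<open>n\<close>-th union, and, at \<open>n = k\<close>, the
  index \<open>m\<close> chosen in the \<open>k\<close>-th union.\<close>

lemma souslin_scheme_INT_UN:
  fixes G :: "nat \<Rightarrow> nat \<Rightarrow> ('p::topological_space \<times> (nat \<Rightarrow> 'b::topological_space)) set"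
  assumes W: "W = (\<Inter>n. \<Union>m. G n m)" "pi0_below r a W"
    and S: "\<And>n m. souslin_scheme r (c n m) (G n m) (S n m)"
    and S_below: "\<And>n m k d. pi0_below r a (S n m k d)"
    and wo: "Well_order r"
  shows "\<exists>R. souslin_scheme r a W R"
proof -
  define dig where "dig d j n = (from_nat (d j) :: nat list) ! n" for d :: "nat \<Rightarrow> nat" and j n
  \<comment> \<open>Thread \<open>n\<close> begins at digit \<open>n\<close>, whose entry
    \<open>n\<close> is the index \<open>m\<close> in the union; the entries \<open>n\<close> of the
    later digits form the branch through \<open>S n m\<close>. At stage \<open>k\<close> the thread
    has consumed \<open>k - Suc n\<close> of these.\<close>
  define T where "T k d n = S n (dig d n n) (k - Suc n) (\<lambda>i. dig d (Suc (n + i)) n)" for k d n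
  \<comment> \<open>Keeping \<open>W\<close> at every stage ensures that a surviving point still
    lies in union number \<open>k\<close> when its index is due. The \<open>if\<close> writes a
    finite intersection as one over all \<open>n\<close>, to fit
    \<open>pi0_below_INT\<close>.\<close>
  define R where "R k d = (\<Inter>n. if n < k then W \<inter> T k d n else W)" for k d
  have R_iff: "x \<in> R k d \<longleftrightarrow> x \<in> W \<and> (\<forall>n<k. x \<in> T k d n)" for x k d
    unfolding R_def by (auto split: if_splits)
  have "W \<subseteq> R 0 d" for d
    by (auto simp: R_iff)
  moreover have "R k d' = R k d" if "d' \<in> cylinder k d" for k d d'
  proof -
    have "T k d' n = T k d n" if "n < k" for n
    proof -
      have "dig d' n n = dig d n n"
        using \<open>d' \<in> cylinder k d\<close> that by (simp add: dig_def cylinder_def)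
      moreover have "(\<lambda>i. dig d' (Suc (n + i)) n) \<in> cylinder (k - Suc n) (\<lambda>i. dig d (Suc (n + i)) n)"
        using \<open>d' \<in> cylinder k d\<close> by (auto simp: dig_def cylinder_def)
      ultimately show ?thesis
        unfolding T_def using souslin_schemeD(2)[OF S] by simp
    qed
    then show ?thesis
      by (auto simp: R_iff)
  qed
  moreover have "R k d \<subseteq> (\<Union>m. R (Suc k) (d(k := m)))" for k d
  proof
    fix x assume x: "x \<in> R k d"
    have "\<exists>m. if n < k then x \<in> S n (dig d n n) (Suc (k - Suc n))
                          ((\<lambda>i. dig d (Suc (n + i)) n)(k - Suc n := m))
              else x \<in> G n m" for n
    proof (cases "n < k")
      case True
      then have "x \<in> T k d n"
        using x by (simp add: R_iff)
      then show ?thesis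
        using True souslin_schemeD(3)[OF S] unfolding T_def by simp
    next
      case False
      then show ?thesis
        using x unfolding R_iff W(1) by simp
    qed
    from choice[OF allI[OF this]] obtain c where
      c: "\<forall>n. if n < k then x \<in> S n (dig d n n) (Suc (k - Suc n))
                          ((\<lambda>i. dig d (Suc (n + i)) n)(k - Suc n := c n))
              else x \<in> G n (c n)" ..
    have c1: "x \<in> S n (dig d n n) (Suc (k - Suc n))
                          ((\<lambda>i. dig d (Suc (n + i)) n)(k - Suc n := c n))" if "n < k" for n
      using c[rule_format, of n] that by (simp only: if_True)
    have c2: "x \<in> G k (c k)"
      using c[rule_format, of k] by (simp only: less_irrefl if_False)
    define d' where "d' = d(k := to_nat (map c [0..<Suc k]))"
    have dig': "dig d' j n = (if j = k then c n else dig d j n)" if "n \<le> k" for j n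
      using that by (simp add: dig_def d'_def nth_map del: upt_Suc)
    have "x \<in> T (Suc k) d' n" if "n < Suc k" for n
    proof (cases "n = k")
      case True
      \<comment> \<open>A newly opened thread stands at stage 0 of its scheme, which contains all of
        \<open>G k (c k)\<close> whatever the branch.\<close>
      have "x \<in> S k (c k) 0 e" for e
        using c2 souslin_schemeD(1)[OF S] by blast
      then show ?thesis
        by (simp add: T_def True dig')
    next
      case False
      then have n: "n < k"
        using that by simp
      have "(\<lambda>i. dig d' (Suc (n + i)) n) = (\<lambda>i. dig d (Suc (n + i)) n)(k - Suc n := c n)"
        using n by (auto simp: dig' fun_eq_iff)
      moreover have "dig d' n n = dig d n n"
        using n by (simp add: dig')
      moreover have "Suc k - Suc n = Suc (k - Suc n)"
        using n by simp
      ultimately show ?thesis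
        using c1[OF n] unfolding T_def by simp
    qed
    then have "x \<in> R (Suc k) d'"
      using x by (simp add: R_iff)
    then show "x \<in> (\<Union>m. R (Suc k) (d(k := m)))"
      unfolding d'_def by blast
  qed
  moreover have "pi0_below r a (R k d)" for k d
    unfolding R_def T_def
    by (rule pi0_below_INT[OF wo]) (simp add: pi0_below_Int[OF wo W(2) S_below] W(2))
  moreover have "(\<alpha>, y) \<in> W" if branch: "\<forall>k. \<exists>z\<in>cylinder k y. (\<alpha>, z) \<in> R k d" for \<alpha> y d
  proof -
    \<comment> \<open>Stage \<open>j\<close> of thread \<open>n\<close> is read off at stage
      \<open>Suc n + j\<close> of \<open>R\<close>; the longer cylinder lies in the one of length
      \<open>j\<close>.\<close>
    have "(\<alpha>, y) \<in> G n (dig d n n)" for n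
    proof (rule souslin_schemeD(5)[OF S])
      fix j
      obtain z where z: "z \<in> cylinder (Suc n + j) y" "(\<alpha>, z) \<in> R (Suc n + j) d"
        using branch by blast
      then have "(\<alpha>, z) \<in> T (Suc n + j) d n"
        by (simp add: R_iff)
      moreover have "z \<in> cylinder j y"
        using z(1) by (auto simp: cylinder_def)
      ultimately show "\<exists>z\<in>cylinder j y. (\<alpha>, z) \<in> S n (dig d n n) j (\<lambda>i. dig d (Suc (n + i)) n)"
        unfolding T_def by auto
    qed
    then show ?thesis
      unfolding W(1) by blast
  qed
  ultimately have "souslin_scheme r a W R"
    unfolding souslin_scheme_def by (intro conjI allI impI)
  then show ?thesis
    by (rule exI[of _ R])
qed

text \<open>Induction on the level. A closed set is its own constant scheme, by approximation in
  cylinders. A set of higher level is, after unfolding two complements, an intersection of unions of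
  sets of lower level, whose schemes are combined.\<close>

lemma ex_souslin_scheme:
  fixes W :: "((nat \<Rightarrow> nat) \<times> (nat \<Rightarrow> int)) set"
  assumes wo: "Well_order r" and "pi0_below r a W"
  shows "\<exists>R. souslin_scheme r a W R"
  using assms
proof (induction a arbitrary: W rule: underS_induct)
  case (less a)
  show ?case
  proof (cases "underS r a = {}")
    case True
    then have W: "closed W"
      using less.prems by (simp add: pi0_below_min_iff)
    have branch: "(\<alpha>, y) \<in> W" if "\<forall>k. \<exists>z\<in>cylinder k y. (\<alpha>, z) \<in> W" for \<alpha> y
    proof (rule closed_prod_cylinderD[OF W])
      fix k
      show "\<exists>a'\<in>cylinder k \<alpha>. \<exists>y'\<in>cylinder k y. (a', y') \<in> W"
        using that by (intro bexI[of _ \<alpha>]) simp_all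
    qed
    have "souslin_scheme r a W (\<lambda>_ _. W)"
      unfolding souslin_scheme_def
      by (intro conjI allI impI less.prems subset_refl refl branch) auto
    then show ?thesis
      by (rule exI[of _ "\<lambda>_ _. W"])
  next
    case False
    then obtain F where F: "\<forall>n::nat. \<exists>b\<in>underS r a. pi0_below r b (F n)" and WF: "W = - (\<Union>n. F n)"
      using less.prems unfolding pi0_below_eq_over[OF False] pi0_over_def by (elim exE conjE) rule
    have "\<exists>G. (\<forall>m. \<exists>c\<in>underS r a. pi0_below r c (G m)) \<and> F n = - (\<Union>m::nat. G m)" for n
    proof -
      obtain b where b: "b \<in> underS r a" "pi0_below r b (F n)"
        using F by blast
      obtain G where G: "(\<forall>m::nat. \<exists>c\<in>insert b (underS r b). pi0_below r c (G m)) \<and> F n = - (\<Union>m. G m)"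
        using pi0_below_Compl[OF wo b(2)] ..
      have "insert b (underS r b) \<subseteq> underS r a"
        using b(1) underS_trans[OF wo] by blast
      then have "\<forall>m. \<exists>c\<in>underS r a. pi0_below r c (G m)"
        using G by blast
      then show ?thesis
        using G by (intro exI[of _ G] conjI) simp_all
    qed
    from choice[OF allI[OF this]] obtain G
      where G: "\<forall>n. (\<forall>m. \<exists>c\<in>underS r a. pi0_below r c (G n m)) \<and> F n = - (\<Union>m::nat. G n m)" ..
    have FG: "F n = - (\<Union>m. G n m)" for n
      using G[rule_format, of n] by (rule conjunct2)
    define c where "c n m = (SOME c. c \<in> underS r a \<and> pi0_below r c (G n m))" for n m
    have "c n m \<in> underS r a \<and> pi0_below r (c n m) (G n m)" for n m
    proof -
      have "\<exists>c. c \<in> underS r a \<and> pi0_below r c (G n m)"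
        using conjunct1[OF G[rule_format, of n]] by blast
      then show ?thesis
        unfolding c_def by (rule someI_ex)
    qed
    then have c: "c n m \<in> underS r a" "pi0_below r (c n m) (G n m)" for n m
      by simp_all
    define S where "S n m = (SOME S. souslin_scheme r (c n m) (G n m) S)" for n m
    have S: "souslin_scheme r (c n m) (G n m) (S n m)" for n m
      unfolding S_def by (rule someI_ex[OF less.IH[OF c]])
    show ?thesis
    proof (rule souslin_scheme_INT_UN[OF _ less.prems S _ wo])
      show "W = (\<Inter>n. \<Union>m. G n m)"
        by (simp add: WF FG)
      show "pi0_below r a (S n m k d)" for n m k d
        by (rule pi0_below_mono[OF wo souslin_schemeD(4)[OF S] c(1)])
    qed
  qed
qed

section \<open>Universal sets\<close>

definition universal_set :: "'i rel \<Rightarrow> 'i \<Rightarrow> ((nat \<Rightarrow> nat) \<times> 'a::topological_space) set \<Rightarrow> bool" where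
  "universal_set r b U \<longleftrightarrow> pi0_below r b U \<and> (\<forall>F. pi0_below r b F \<longrightarrow> (\<exists>\<beta>. F = {y. (\<beta>, y) \<in> U}))"

text \<open>The level of \<open>V n\<close> is fixed in advance while that of \<open>F n\<close> is
  arbitrary, so only the unions can match. Each level therefore receives infinitely many slots:
  index \<open>n\<close> codes a level together with a slot number.\<close>

lemma ex_universal_sequence:
  fixes L :: "'i set"
  assumes wo: "Well_order r" and L: "countable L" "L \<noteq> {}"
    and univ: "\<And>b. b \<in> L \<Longrightarrow>
      \<exists>U::((nat \<Rightarrow> nat) \<times> 'a::{second_countable_topology, zero_dimensional_space}) set. universal_set r b U"
  shows "\<exists>V::nat \<Rightarrow> ((nat \<Rightarrow> nat) \<times> 'a) set. (\<forall>n. \<exists>b\<in>L. pi0_below r b (V n)) \<and>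
    (\<forall>F. (\<forall>n::nat. \<exists>b\<in>L. pi0_below r b (F n)) \<longrightarrow> (\<exists>\<beta>. (\<Union>n. {y. (\<beta>, y) \<in> V n}) = (\<Union>n. F n)))"
proof -
  define U :: "'i \<Rightarrow> ((nat \<Rightarrow> nat) \<times> 'a) set" where "U b = (SOME U. universal_set r b U)" for b
  have U: "universal_set r b (U b)" if "b \<in> L" for b
    unfolding U_def by (rule someI_ex[OF univ[OF that]])
  define e where "e = from_nat_into L"
  have e: "e i \<in> L" for i
    unfolding e_def using L(2) by (rule from_nat_into)
  have e_onto: "\<exists>i. e i = b" if "b \<in> L" for b
    using from_nat_into_surj[OF L(1) that] unfolding e_def .
  define lev where "lev n = e (fst (prod_decode n))" for n
  \<comment> \<open>Row \<open>n\<close> of the parameter serves slot \<open>n\<close>, so that all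
    slots can be prescribed independently.\<close>
  define sec where "sec n = (\<lambda>p::(nat \<Rightarrow> nat) \<times> 'a. (\<lambda>m. fst p (prod_encode (n, m)), snd p))" for n
  have "continuous_on UNIV (\<lambda>p::(nat \<Rightarrow> nat) \<times> 'a. fst p i)" for i
    by (rule continuous_on_coord[OF continuous_on_fst[OF continuous_on_id]])
  then have cont: "continuous_on UNIV (sec n)" for n
    unfolding sec_def
    by (intro continuous_on_Pair continuous_on_coordinatewise_then_product
        continuous_on_snd[OF continuous_on_id])
  define V where "V n = sec n -` U (lev n)" for n
  have "\<exists>b\<in>L. pi0_below r b (V n)" for n
  proof
    show "lev n \<in> L"
      unfolding lev_def by (rule e)
    then have "pi0_below r (lev n) (U (lev n))"
      using U unfolding universal_set_def by blast
    then show "pi0_below r (lev n) (V n)"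
      unfolding V_def by (rule pi0_below_vimage[OF wo _ cont])
  qed
  moreover have "\<exists>\<beta>. (\<Union>n. {y. (\<beta>, y) \<in> V n}) = (\<Union>n. F n)"
    if F: "\<forall>n::nat. \<exists>b\<in>L. pi0_below r b (F n)" for F
  proof -
    from F have "\<forall>n. \<exists>b. b \<in> L \<and> pi0_below r b (F n)"
      by blast
    from choice[OF this] obtain b where b: "\<forall>n. b n \<in> L \<and> pi0_below r (b n) (F n)" ..
    \<comment> \<open>\<open>F j\<close> goes to slot \<open>j\<close> of its own level; every other
      slot receives the empty set, which is closed and hence available at every level.\<close>
    define T where "T n = (if lev n = b (snd (prod_decode n)) then F (snd (prod_decode n)) else {})" for n
    have "\<exists>\<beta>. T n = {y. (\<beta>, y) \<in> U (lev n)}" for n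
    proof -
      have "pi0_below r (lev n) (T n)"
        using b by (simp add: T_def closed_imp_pi0_below[OF wo])
      moreover have "lev n \<in> L"
        unfolding lev_def by (rule e)
      ultimately show ?thesis
        using U[of "lev n"] unfolding universal_set_def by simp
    qed
    from choice[OF allI[OF this]] obtain \<beta>s where \<beta>s: "\<forall>n. T n = {y. (\<beta>s n, y) \<in> U (lev n)}" ..
    define \<beta> where "\<beta> k = \<beta>s (fst (prod_decode k)) (snd (prod_decode k))" for k
    have T: "{y. (\<beta>, y) \<in> V n} = T n" for n
      using \<beta>s[rule_format, of n] by (simp add: V_def sec_def \<beta>_def)
    have "(\<Union>n. T n) = (\<Union>n. F n)"
    proof
      show "(\<Union>n. T n) \<subseteq> (\<Union>n. F n)"
        unfolding T_def by (auto split: if_splits)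
      show "(\<Union>n. F n) \<subseteq> (\<Union>n. T n)"
      proof (rule UN_least)
        fix j
        obtain i where "e i = b j"
          using e_onto b by blast
        then have "T (prod_encode (i, j)) = F j"
          by (simp add: T_def lev_def)
        then show "F j \<subseteq> (\<Union>n. T n)"
          by blast
      qed
    qed
    then show ?thesis
      using T by (intro exI[of _ \<beta>]) simp
  qed
  ultimately show ?thesis
    by (intro exI[of _ V] conjI allI impI)
qed

lemma ex_universal_closed:
  shows "\<exists>U::((nat \<Rightarrow> nat) \<times> 'a::second_countable_topology) set. closed U \<and>
    (\<forall>F. closed F \<longrightarrow> (\<exists>\<beta>. F = {y. (\<beta>, y) \<in> U}))"
proof -
  obtain B :: "'a set set" where "countable B \<and> topological_basis B"
    using ex_countable_basis ..
  then have B: "countable B" "topological_basis B"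
    by simp_all
  define e where "e = from_nat_into (insert {} B)"
  have range_e: "range e = insert {} B"
    unfolding e_def by (rule range_from_nat_into) (use B(1) in auto)
  have open_e: "open (e n)" for n
  proof -
    have "e n \<in> insert {} B"
      unfolding range_e[symmetric] by simp
    then show ?thesis
      using topological_basis_open[OF B(2)] by (elim insertE) simp_all
  qed
  have "{} \<in> range e"
    unfolding range_e by simp
  then obtain k0 where "{} = e k0"
    by (rule rangeE)
  then have k0: "e k0 = {}"
    by (rule sym)
  define U :: "((nat \<Rightarrow> nat) \<times> 'a) set" where "U = {(\<beta>, y). \<forall>n. y \<notin> e (\<beta> n)}"
  have "- U = (\<Union>n. \<Union>k. ((\<lambda>\<beta>. \<beta> n) -` {k}) \<times> e k)"
    unfolding U_def by auto
  moreover have "open \<dots>"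
    by (intro open_UN ballI open_Times open_e open_vimage continuous_on_product_coordinates
        Topological_Spaces.open_discrete)
  ultimately have "closed U"
    by (simp add: closed_def)
  moreover have "\<exists>\<beta>. F = {y. (\<beta>, y) \<in> U}" if "closed F" for F
  proof (rule exI)
    \<comment> \<open>The index \<open>k0\<close> of the empty set replaces every basic set that
      meets \<open>F\<close>, so the listed sets have union exactly \<open>- F\<close>.\<close>
    let ?\<beta> = "\<lambda>n. if e n \<subseteq> - F then n else k0"
    have "\<exists>n. y \<in> e (?\<beta> n)" if y: "y \<in> - F" for y
    proof -
      obtain b where "b \<in> B" "y \<in> b" "b \<subseteq> - F"
        by (rule topological_basisE[OF B(2) open_Compl[OF \<open>closed F\<close>] y])
      moreover obtain n where "b = e n"
        using range_e \<open>b \<in> B\<close> by blast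
      ultimately show ?thesis
        by (intro exI[of _ n]) simp
    qed
    moreover have "e (?\<beta> n) \<subseteq> - F" for n
      by (simp add: k0)
    ultimately have "- F = (\<Union>n. e (?\<beta> n))"
      by blast
    moreover have "{y. (?\<beta>, y) \<in> U} = - (\<Union>n. e (?\<beta> n))"
      unfolding U_def by blast
    ultimately show "F = {y. (?\<beta>, y) \<in> U}"
      by (metis double_complement)
  qed
  ultimately show ?thesis
    by (intro exI[of _ U] conjI allI impI)
qed

text \<open>Induction on the level: at the bottom a parameter lists basic open sets covering the
  complement; above, the complement of the union of a universal sequence for the countably many
  lower levels works.\<close>

lemma ex_universal_set:
  fixes r :: "'i::countable rel"
  assumes wo: "Well_order r"
  shows "\<exists>U::((nat \<Rightarrow> nat) \<times> 'a::{second_countable_topology, zero_dimensional_space}) set. universal_set r a U"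
  using assms
proof (induction a rule: underS_induct)
  case (less a)
  show ?case
  proof (cases "underS r a = {}")
    case True
    then show ?thesis
      unfolding universal_set_def pi0_below_min_iff[OF True] by (intro ex_universal_closed)
  next
    case False
    obtain V :: "nat \<Rightarrow> ((nat \<Rightarrow> nat) \<times> 'a) set" where
      V: "(\<forall>n. \<exists>b\<in>underS r a. pi0_below r b (V n)) \<and>
        (\<forall>F. (\<forall>n::nat. \<exists>b\<in>underS r a. pi0_below r b (F n)) \<longrightarrow> (\<exists>\<beta>. (\<Union>n. {y. (\<beta>, y) \<in> V n}) = (\<Union>n. F n)))"
      using ex_universal_sequence[OF wo countableI_type False less.IH] ..
    have "pi0_below r a (- (\<Union>n. V n))"
      using V by (intro pi0_below.step[OF False]) simp
    moreover have "\<exists>\<beta>. A = {y. (\<beta>, y) \<in> - (\<Union>n. V n)}" if A: "pi0_below r a A" for A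
    proof -
      obtain F where F: "(\<forall>n::nat. \<exists>b\<in>underS r a. pi0_below r b (F n)) \<and> A = - (\<Union>n. F n)"
        using A unfolding pi0_below_eq_over[OF False] pi0_over_def ..
      obtain \<beta> where \<beta>: "(\<Union>n. {y. (\<beta>, y) \<in> V n}) = (\<Union>n. F n)"
        using conjunct2[OF V, rule_format, OF conjunct1[OF F, rule_format]] ..
      have "{y. (\<beta>, y) \<in> - (\<Union>n. V n)} = - (\<Union>n. {y. (\<beta>, y) \<in> V n})"
        by auto
      also have "\<dots> = A"
        unfolding \<beta> using F by simp
      finally show ?thesis
        by (intro exI[of _ \<beta>]) simp
    qed
    ultimately show ?thesis
      unfolding universal_set_def by (intro exI[of _ "- (\<Union>n. V n)"] conjI allI impI)
  qed
qed

section \<open>Measures of sections\<close>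

definition prod_pmf_measure :: "(nat \<Rightarrow> int pmf) \<Rightarrow> (nat \<Rightarrow> int) measure" where
  "prod_pmf_measure p = PiM UNIV (\<lambda>i. measure_pmf (p i))"

lemma sets_prod_pmf_measure [measurable_cong, simp]: "sets (prod_pmf_measure p) = sets borel"
proof -
  have "sets (prod_pmf_measure p) = sets (PiM UNIV (\<lambda>_::nat. borel :: int measure))"
    unfolding prod_pmf_measure_def by (rule sets_PiM_cong) (simp_all add: sets_borel_eq_count_space)
  then show ?thesis
    by (simp add: sets_PiM_equal_borel)
qed

lemma space_prod_pmf_measure [simp]: "space (prod_pmf_measure p) = UNIV"
  using sets_eq_imp_space_eq[OF sets_prod_pmf_measure[of p]] by simp

lemma prob_space_prod_pmf_measure: "prob_space (prod_pmf_measure p)"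
  unfolding prod_pmf_measure_def by (intro prob_space_PiM measure_pmf.prob_space_axioms)

lemma product_prob_space_pmf: "product_prob_space (\<lambda>i. measure_pmf (p i))"
  by unfold_locales

lemma emeasure_prod_pmf_box:
  assumes "finite J"
  shows "emeasure (prod_pmf_measure p) {x. \<forall>i\<in>J. x i \<in> A i} = (\<Prod>i\<in>J. emeasure (measure_pmf (p i)) (A i))"
  using product_prob_space.emeasure_PiM_Collect[OF product_prob_space_pmf, of J UNIV A p] assms
    space_prod_pmf_measure[of p]
  unfolding prod_pmf_measure_def by simp

lemma measure_prod_pmf_coord:
  "measure (prod_pmf_measure p) {x. x i \<in> A} = measure (measure_pmf (p i)) A"
  using emeasure_prod_pmf_box[of "{i}" p "\<lambda>_. A"] by (simp add: measure_def)

lemma continuous_on_coordwise: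
  fixes f :: "nat \<Rightarrow> int \<Rightarrow> int"
  shows "continuous_on UNIV (\<lambda>z i. f i (z i))"
  by (rule continuous_on_coordinatewise_then_product
      [OF continuous_on_compose_discrete[OF continuous_on_product_coordinates]])

lemma measurable_coordwise:
  fixes f :: "nat \<Rightarrow> int \<Rightarrow> int"
  shows "(\<lambda>z i. f i (z i)) \<in> measurable (prod_pmf_measure p) borel"
  unfolding measurable_cong_sets[OF sets_prod_pmf_measure refl]
  by (rule borel_measurable_continuous_onI[OF continuous_on_coordwise])

lemma distr_prod_pmf_measure:
  "distr (prod_pmf_measure p) borel (\<lambda>z i. f i (z i)) = prod_pmf_measure (\<lambda>i. map_pmf (f i) (p i))"
    (is "?L = ?R")
proof -
  let ?M = "\<lambda>i. measure_pmf (map_pmf (f i) (p i))"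
  note meas = measurable_coordwise[of f p]
  have "?L = PiM UNIV ?M"
  proof (rule product_prob_space.PiM_eq[OF product_prob_space_pmf])
    show "sets ?L = sets (PiM UNIV ?M)"
      using sets_prod_pmf_measure[of "\<lambda>i. map_pmf (f i) (p i)"] by (simp add: prod_pmf_measure_def)
    fix J :: "nat set" and F :: "nat \<Rightarrow> int set"
    assume J: "finite J"
    have emb: "prod_emb UNIV ?M J (Pi\<^sub>E J F) = {x. \<forall>j\<in>J. x j \<in> F j}"
      by (auto simp: prod_emb_def PiE_iff)
    have "{x. \<forall>j\<in>J. x j \<in> F j} = (\<Inter>j\<in>J. (\<lambda>x. x j) -` F j)"
      by auto
    moreover have "open \<dots>"
      by (intro open_INT J ballI open_vimage continuous_on_product_coordinates
          Topological_Spaces.open_discrete)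
    ultimately have "{x. \<forall>j\<in>J. x j \<in> F j} \<in> sets borel"
      by simp
    then have "emeasure ?L {x. \<forall>j\<in>J. x j \<in> F j} = emeasure (prod_pmf_measure p) {z. \<forall>j\<in>J. z j \<in> f j -` F j}"
      using emeasure_distr[OF meas, of "{x. \<forall>j\<in>J. x j \<in> F j}"] by (simp add: vimage_def)
    also have "\<dots> = (\<Prod>j\<in>J. emeasure (?M j) (F j))"
      unfolding emeasure_prod_pmf_box[OF J] emeasure_map_pmf ..
    finally show "emeasure ?L (prod_emb UNIV ?M J (Pi\<^sub>E J F)) = (\<Prod>j\<in>J. emeasure (?M j) (F j))"
      unfolding emb .
  qed
  then show ?thesis
    by (simp add: prod_pmf_measure_def)
qed

lemma measure_prod_pmf_vimage:
  assumes "S \<in> sets borel"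
  shows "measure (prod_pmf_measure (\<lambda>i. map_pmf (f i) (p i))) S = measure (prod_pmf_measure p) {z. (\<lambda>i. f i (z i)) \<in> S}"
  using measure_distr[OF measurable_coordwise[of f p] assms]
  by (simp add: distr_prod_pmf_measure vimage_def)

text \<open>Resetting all coordinates from \<open>k\<close> on to 0 does not affect membership in
  \<open>S\<close>, and it makes the two product measures equal.\<close>

lemma measure_prod_pmf_cong:
  assumes S: "\<And>y z. y \<in> S \<Longrightarrow> z \<in> cylinder k y \<Longrightarrow> z \<in> S" and "\<And>i. i < k \<Longrightarrow> p i = q i"
  shows "measure (prod_pmf_measure p) S = measure (prod_pmf_measure q) S"
proof -
  let ?f = "\<lambda>i x. if i < k then x else 0"
  have "S \<in> sets borel"
    using open_finitely_determined[of S k] S by simp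
  have *: "measure (prod_pmf_measure p) S = measure (prod_pmf_measure (\<lambda>i. map_pmf (?f i) (p i))) S" for p
  proof -
    have "(\<lambda>i. ?f i (z i)) \<in> S \<longleftrightarrow> z \<in> S" for z
      using S[of z "\<lambda>i. ?f i (z i)"] S[of "\<lambda>i. ?f i (z i)" z] by (auto simp: cylinder_def)
    then show ?thesis
      by (simp add: measure_prod_pmf_vimage[OF \<open>S \<in> sets borel\<close>])
  qed
  have "map_pmf (?f i) (p i) = map_pmf (?f i) (q i)" for i
    using assms(2)[of i] by (cases "i < k") (auto simp: map_pmf_const)
  then show ?thesis
    by (subst (1 2) *) simp
qed

text \<open>Upper semicontinuity: the section of \<open>W\<close> at \<alpha> is the decreasing
  limit of the sets \<open>Wk k \<alpha>\<close> of points that cannot be separated from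
  \<open>W\<close> by the first \<open>k\<close> coordinates. The measure of
  \<open>Wk k \<alpha>\<close> depends on only \<open>k\<close> coordinates of \<alpha>, so bounding
  it below is a closed condition.\<close>

lemma closed_measure_section_ge:
  fixes W :: "((nat \<Rightarrow> 'p::discrete_topology) \<times> (nat \<Rightarrow> int)) set"
  assumes "closed W"
  shows "closed {\<alpha>. q \<le> measure (prod_pmf_measure (\<lambda>i. u (\<alpha> i))) {y. (\<alpha>, y) \<in> W}}"
proof -
  define \<rho> where "\<rho> \<alpha> = prod_pmf_measure (\<lambda>i. u (\<alpha> i))" for \<alpha> :: "nat \<Rightarrow> 'p"
  define Wk where "Wk k \<alpha> = {y. \<exists>\<alpha>'\<in>cylinder k \<alpha>. \<exists>y'\<in>cylinder k y. (\<alpha>', y') \<in> W}" for k \<alpha>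
  have det: "z \<in> Wk k \<alpha>" if "y \<in> Wk k \<alpha>" "z \<in> cylinder k y" for y z k \<alpha>
    using that unfolding Wk_def cylinder_def by simp
  have borel: "Wk k \<alpha> \<in> sets borel" for k \<alpha>
    using open_finitely_determined[of "Wk k \<alpha>" k, OF det] by simp
  have Wk_cong: "Wk k \<alpha>' = Wk k \<alpha>" if "\<alpha>' \<in> cylinder k \<alpha>" for k \<alpha> \<alpha>'
  proof -
    have "cylinder k \<alpha>' = cylinder k \<alpha>"
      using that by (auto simp: cylinder_def)
    then show ?thesis
      by (simp add: Wk_def)
  qed
  have closed_k: "closed {\<alpha>. q \<le> measure (\<rho> \<alpha>) (Wk k \<alpha>)}" for k
  proof -
    have "measure (\<rho> \<alpha>') (Wk k \<alpha>') = measure (\<rho> \<alpha>) (Wk k \<alpha>)" if "\<alpha>' \<in> cylinder k \<alpha>" for \<alpha> \<alpha>'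
      unfolding Wk_cong[OF that] \<rho>_def
      by (rule measure_prod_pmf_cong[of _ k, OF det]) (use that in \<open>auto simp: cylinder_def\<close>)
    then have "open (- {\<alpha>. q \<le> measure (\<rho> \<alpha>) (Wk k \<alpha>)})"
      by (intro open_finitely_determined[of _ k]) simp
    then show ?thesis
      by (simp add: closed_def)
  qed
  have Inter: "(\<Inter>k. Wk k \<alpha>) = {y. (\<alpha>, y) \<in> W}" for \<alpha>
  proof
    show "(\<Inter>k. Wk k \<alpha>) \<subseteq> {y. (\<alpha>, y) \<in> W}"
    proof
      fix y assume "y \<in> (\<Inter>k. Wk k \<alpha>)"
      then show "y \<in> {y. (\<alpha>, y) \<in> W}"
        using closed_prod_cylinderD[OF assms, of \<alpha> y] by (simp add: Wk_def)
    qed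
    show "{y. (\<alpha>, y) \<in> W} \<subseteq> (\<Inter>k. Wk k \<alpha>)"
    proof (intro subsetI INT_I)
      fix y k assume "y \<in> {y. (\<alpha>, y) \<in> W}"
      then show "y \<in> Wk k \<alpha>"
        unfolding Wk_def by (auto intro!: bexI[of _ \<alpha>] bexI[of _ y])
    qed
  qed
  have dec: "decseq (\<lambda>k. Wk k \<alpha>)" for \<alpha>
  proof (rule antimonoI)
    fix k l :: nat
    assume "k \<le> l"
    then show "Wk l \<alpha> \<subseteq> Wk k \<alpha>"
    proof -
      have "cylinder l \<alpha> \<subseteq> cylinder k \<alpha>"
        by (rule cylinder_mono[OF \<open>k \<le> l\<close>])
      moreover have "cylinder l y \<subseteq> cylinder k y" for y :: "nat \<Rightarrow> int"
        by (rule cylinder_mono[OF \<open>k \<le> l\<close>])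
      ultimately show ?thesis
        unfolding Wk_def by (intro Collect_mono impI) (meson subsetD)
    qed
  qed
  have "{\<alpha>. q \<le> measure (\<rho> \<alpha>) {y. (\<alpha>, y) \<in> W}} = (\<Inter>k. {\<alpha>. q \<le> measure (\<rho> \<alpha>) (Wk k \<alpha>)})"
  proof (intro set_eqI iffI)
    fix \<alpha>
    interpret prob_space "\<rho> \<alpha>"
      unfolding \<rho>_def by (rule prob_space_prod_pmf_measure)
    have ev: "Wk k \<alpha> \<in> events" for k
      using borel by (simp add: \<rho>_def)
    have lim: "(\<lambda>k. prob (Wk k \<alpha>)) \<longlonglongrightarrow> prob {y. (\<alpha>, y) \<in> W}"
      unfolding Inter[symmetric] by (rule finite_Lim_measure_decseq) (use ev dec in auto)
    show "\<alpha> \<in> (\<Inter>k. {\<alpha>. q \<le> measure (\<rho> \<alpha>) (Wk k \<alpha>)})"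
      if "\<alpha> \<in> {\<alpha>. q \<le> measure (\<rho> \<alpha>) {y. (\<alpha>, y) \<in> W}}"
    proof -
      have "prob {y. (\<alpha>, y) \<in> W} \<le> prob (Wk k \<alpha>)" for k
        unfolding Inter[symmetric] by (rule finite_measure_mono[OF _ ev]) blast
      then show ?thesis
        using that by (auto intro: order_trans)
    qed
    show "\<alpha> \<in> {\<alpha>. q \<le> measure (\<rho> \<alpha>) {y. (\<alpha>, y) \<in> W}}"
      if "\<alpha> \<in> (\<Inter>k. {\<alpha>. q \<le> measure (\<rho> \<alpha>) (Wk k \<alpha>)})"
      using LIMSEQ_le_const[OF lim, of q] that by simp
  qed
  then show ?thesis
    unfolding \<rho>_def[symmetric] using closed_INT[of UNIV, OF ballI, OF closed_k] by simp
qed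

lemma measurable_section:
  fixes W :: "((nat \<Rightarrow> nat) \<times> (nat \<Rightarrow> int)) set"
  assumes "Well_order r" "pi0_below r a W"
  shows "{y. (\<alpha>, y) \<in> W} \<in> sets borel"
proof -
  have "continuous_on UNIV (\<lambda>y::nat \<Rightarrow> int. (\<alpha>, y))"
    by (intro continuous_on_Pair continuous_on_const continuous_on_id)
  from pi0_below_borel[OF assms(1) pi0_below_vimage[OF assms this]] show ?thesis
    by (simp add: vimage_def)
qed

text \<open>Induction on the level. If the complement of \<open>W\<close> is the increasing union of
  the \<open>G N\<close>, then measure at least \<open>q\<close> means that no \<open>G N\<close>
  has measure above \<open>1 - q\<close>; by induction this is a countable intersection of
  complements of sets of lower level.\<close>

lemma pi0_below_measure_section_ge:
  fixes W :: "((nat \<Rightarrow> nat) \<times> (nat \<Rightarrow> int)) set"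
  assumes wo: "Well_order r" and "pi0_below r a W"
  shows "pi0_below r a {\<alpha>. q \<le> measure (prod_pmf_measure (\<lambda>i. u (\<alpha> i))) {y. (\<alpha>, y) \<in> W}}"
  using assms
proof (induction a arbitrary: W q rule: underS_induct)
  case (less a)
  define \<rho> where "\<rho> \<alpha> = prod_pmf_measure (\<lambda>i. u (\<alpha> i))" for \<alpha> :: "nat \<Rightarrow> nat"
  show ?case
  proof (cases "underS r a = {}")
    case True
    then show ?thesis
      using less.prems closed_measure_section_ge by (simp only: pi0_below_min_iff)
  next
    case False
    obtain F where F: "(\<forall>n::nat. \<exists>b\<in>underS r a. pi0_below r b (F n)) \<and> W = - (\<Union>n. F n)"
      using less.prems unfolding pi0_below_eq_over[OF False] pi0_over_def ..
    \<comment> \<open>Partial unions are used because measure is continuous along increasing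
      sequences; being finite, each still has a single level below \<open>a\<close>.\<close>
    define G where "G N = (\<Union>n\<le>N. F n)" for N
    have G: "\<exists>c\<in>underS r a. pi0_below r c (G N)" for N
    proof (induction N)
      case 0
      then show ?case
        using F by (simp add: G_def)
    next
      case (Suc N)
      then obtain c where c: "c \<in> underS r a" "pi0_below r c (G N)" ..
      obtain b where b: "b \<in> underS r a" "pi0_below r b (F (Suc N))"
        using conjunct1[OF F, rule_format, of "Suc N"] ..
      obtain d where "d \<in> underS r a" "pi0_below r d (G N)" "pi0_below r d (F (Suc N))"
        by (rule pi0_below_max[OF wo c(1) b(1) Order_Relation.underS_Field c(2) b(2)])
      moreover have "G (Suc N) = G N \<union> F (Suc N)"
        by (auto simp: G_def atMost_Suc)
      ultimately show ?case
        using pi0_below_Un[OF wo, of d "G N" "F (Suc N)"] by metis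
    qed
    \<comment> \<open>The bound \<open>\<le> 1 - q\<close> is split into the strict bounds
      \<open>< 1 - q + 1 / real (Suc k)\<close>, each the negation of a condition covered by the
      induction hypothesis.\<close>
    have "{\<alpha>. q \<le> measure (\<rho> \<alpha>) {y. (\<alpha>, y) \<in> W}} =
        (\<Inter>(N, k). - {\<alpha>. 1 - q + 1 / real (Suc k) \<le> measure (\<rho> \<alpha>) {y. (\<alpha>, y) \<in> G N}})"
    proof (rule set_eqI)
      fix \<alpha>
      interpret prob_space "\<rho> \<alpha>"
        unfolding \<rho>_def by (rule prob_space_prod_pmf_measure)
      have ev: "{y. (\<alpha>, y) \<in> G N} \<in> events" for N
        using G[of N] measurable_section[OF wo] by (auto simp: \<rho>_def)
      have W_eq: "{y. (\<alpha>, y) \<in> W} = space (\<rho> \<alpha>) - (\<Union>N. {y. (\<alpha>, y) \<in> G N})"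
        unfolding conjunct2[OF F] by (auto simp: G_def \<rho>_def)
      have "prob {y. (\<alpha>, y) \<in> W} = 1 - prob (\<Union>N. {y. (\<alpha>, y) \<in> G N})"
        unfolding W_eq by (rule prob_compl) (use ev in auto)
      moreover have lim: "(\<lambda>N. prob {y. (\<alpha>, y) \<in> G N}) \<longlonglongrightarrow> prob (\<Union>N. {y. (\<alpha>, y) \<in> G N})"
        by (rule finite_Lim_measure_incseq) (use ev in \<open>auto simp: incseq_def G_def\<close>)
      moreover have "prob {y. (\<alpha>, y) \<in> G N} \<le> prob (\<Union>N. {y. (\<alpha>, y) \<in> G N})" for N
        by (rule finite_measure_mono) (use ev in auto)
      ultimately have "q \<le> prob {y. (\<alpha>, y) \<in> W} \<longleftrightarrow> (\<forall>N. prob {y. (\<alpha>, y) \<in> G N} \<le> 1 - q)"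
        using LIMSEQ_le_const2[OF lim, of "1 - q"] by (smt (verit, best))
      also have "\<dots> \<longleftrightarrow> (\<forall>N k. prob {y. (\<alpha>, y) \<in> G N} < 1 - q + 1 / real (Suc k))"
      proof (intro iff_allI iffI allI)
        fix N
        show "prob {y. (\<alpha>, y) \<in> G N} \<le> 1 - q"
          if *: "\<forall>k. prob {y. (\<alpha>, y) \<in> G N} < 1 - q + 1 / real (Suc k)"
        proof (rule field_le_epsilon)
          fix e :: real
          assume "0 < e"
          then obtain k where "1 / real (Suc k) < e"
            using nat_approx_posE by blast
          then show "prob {y. (\<alpha>, y) \<in> G N} \<le> 1 - q + e"
            using *[rule_format, of k] by linarith
        qed
        show "prob {y. (\<alpha>, y) \<in> G N} < 1 - q + 1 / real (Suc k)"
          if "prob {y. (\<alpha>, y) \<in> G N} \<le> 1 - q" for k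
          using that by (rule le_less_trans) simp
      qed
      finally show "\<alpha> \<in> {\<alpha>. q \<le> measure (\<rho> \<alpha>) {y. (\<alpha>, y) \<in> W}} \<longleftrightarrow>
          \<alpha> \<in> (\<Inter>(N, k). - {\<alpha>. 1 - q + 1 / real (Suc k) \<le> measure (\<rho> \<alpha>) {y. (\<alpha>, y) \<in> G N}})"
        by (simp add: not_le split: prod.split)
    qed
    moreover have sets: "pi0_over r (underS r a) (case p of (N, k) \<Rightarrow>
        - {\<alpha>. 1 - q + 1 / real (Suc k) \<le> measure (\<rho> \<alpha>) {y. (\<alpha>, y) \<in> G N}})" for p
    proof -
      obtain N k where p: "p = (N, k)"
        by (rule prod.exhaust)
      obtain c where c: "c \<in> underS r a" "pi0_below r c (G N)"
        using G ..
      show ?thesis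
        unfolding p prod.case \<rho>_def by (rule pi0_over_Compl_below[OF wo less.IH[OF c] c(1)])
    qed
    ultimately show ?thesis
      unfolding pi0_below_eq_over[OF False] \<rho>_def[symmetric] using pi0_over_INT[OF wo sets] by simp
  qed
qed

section \<open>Haar null sets and uniform measures on blocks\<close>

text \<open>The left ends \<open>4 ^ k\<close> keep different blocks at least 2 apart; the length
  \<open>2 ^ k\<close> makes a fixed translation nearly preserve the uniform measure on a block of
  large index.\<close>

definition block :: "nat \<Rightarrow> int set" where
  "block k = {4 ^ k..<4 ^ k + 2 ^ k}"

definition block_measure :: "(nat \<Rightarrow> nat) \<Rightarrow> (nat \<Rightarrow> int) measure" where
  "block_measure \<alpha> = prod_pmf_measure (\<lambda>i. pmf_of_set (block (\<alpha> i)))"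

lemma finite_block [simp]: "finite (block k)" and block_nonempty [simp]: "block k \<noteq> {}"
  and card_block: "card (block k) = 2 ^ k"
  by (simp_all add: block_def)

text \<open>A shift by \<open>c\<close> pushes at most \<open>\<bar>c\<bar>\<close> points out of
  the block, all at one end.\<close>

lemma measure_block_exit_le:
  "measure (pmf_of_set (block k)) {x. x \<notin> block k \<or> x + c \<notin> block k} \<le> real_of_int \<bar>c\<bar> / 2 ^ k"
proof -
  have "card (block k \<inter> {x. x \<notin> block k \<or> x + c \<notin> block k}) \<le> nat \<bar>c\<bar>"
  proof (cases "c \<ge> 0")
    case True
    then have "block k \<inter> {x. x \<notin> block k \<or> x + c \<notin> block k} \<subseteq> {4 ^ k + 2 ^ k - c..<4 ^ k + 2 ^ k}"
      by (auto simp: block_def)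
    from card_mono[OF _ this] show ?thesis
      using True by simp
  next
    case False
    then have "block k \<inter> {x. x \<notin> block k \<or> x + c \<notin> block k} \<subseteq> {4 ^ k..<4 ^ k - c}"
      by (auto simp: block_def)
    from card_mono[OF _ this] show ?thesis
      using False by simp
  qed
  then have "real (card (block k \<inter> {x. x \<notin> block k \<or> x + c \<notin> block k})) \<le> real_of_int \<bar>c\<bar>"
    by linarith
  then show ?thesis
    by (simp add: measure_pmf_of_set card_block divide_right_mono)
qed

text \<open>The cyclic shift preserves the uniform measure exactly, and it coincides with
  translation by \<open>c\<close> at the points that stay inside the block.\<close>

lemma map_pmf_rotate_block:
  "map_pmf (\<lambda>x. 4 ^ k + (x - 4 ^ k + c) mod 2 ^ k) (pmf_of_set (block k)) = pmf_of_set (block k)"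
proof (rule map_pmf_of_set_bij_betw)
  let ?f = "\<lambda>x::int. 4 ^ k + (x - 4 ^ k + c) mod 2 ^ k"
  have "inj_on ?f (block k)"
  proof (rule inj_onI)
    fix x y assume xy: "x \<in> block k" "y \<in> block k" "?f x = ?f y"
    then have "2 ^ k dvd (x - 4 ^ k + c) - (y - 4 ^ k + c)"
      by (simp only: add_left_cancel mod_eq_dvd_iff)
    then have dvd: "2 ^ k dvd x - y"
      by simp
    have "\<bar>x - y\<bar> < 2 ^ k"
      using xy(1,2) by (auto simp: block_def)
    then have "x - y = 0"
      using dvd_imp_le_int[OF _ dvd] by fastforce
    then show "x = y"
      by simp
  qed
  moreover have "?f ` block k \<subseteq> block k"
    by (auto simp: block_def)
  ultimately show "bij_betw ?f (block k) (block k)"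
    by (simp add: bij_betw_def endo_inj_surj)
qed simp_all

lemma (in prob_space) prob_UN_le_half:
  assumes "\<And>i::nat. A i \<in> events" "\<And>i. prob (A i) \<le> (1 / 2) ^ (i + 2)"
  shows "prob (\<Union>i. A i) \<le> 1 / 2"
proof -
  have s: "(\<lambda>i. (1 / 2 :: real) ^ (i + 2)) sums (1 / 2)"
    using sums_mult2[OF geometric_sums[of "1 / 2 :: real"], of "(1 / 2)\<^sup>2"]
    by (simp add: power_add power2_eq_square)
  have summ: "summable (\<lambda>i. prob (A i))"
    by (rule summable_comparison_test'[OF sums_summable[OF s]]) (use assms(2) in simp)
  have "prob (\<Union>i. A i) \<le> (\<Sum>i. prob (A i))"
    by (rule finite_measure_subadditive_countably[OF _ summ]) (use assms(1) in auto)
  also have "\<dots> \<le> (\<Sum>i. (1 / 2) ^ (i + 2))"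
    by (rule suminf_le[OF assms(2) summ sums_summable[OF s]])
  also have "\<dots> = 1 / 2"
    using sums_unique[OF s] by simp
  finally show ?thesis .
qed

section \<open>Haar null sets and block measures, by tightness and Fubini\<close>

lemma open_coord_set: "open {y :: nat \<Rightarrow> int. P (y i)}"
  using open_vimage[OF Topological_Spaces.open_discrete[of "Collect P"] continuous_on_product_coordinates[of i]]
  by (simp add: vimage_def)

text \<open>Tightness: \<open>b i\<close> is chosen so that coordinate \<open>i\<close> leaves its
  interval with probability at most \<open>(1 / 2) ^ (i + 2)\<close>, and these bounds sum to
  1/2.\<close>

lemma ex_box_positive_measure:
  fixes \<mu> :: "(nat \<Rightarrow> int) measure"
  assumes "prob_space \<mu>" and sets: "sets \<mu> = sets borel"
  shows "\<exists>b::nat \<Rightarrow> nat. measure \<mu> (- {y. \<forall>i. \<bar>y i\<bar> \<le> int (b i)}) \<le> 1 / 2"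
proof -
  interpret prob_space \<mu> by fact
  have sp: "space \<mu> = UNIV"
    using sets_eq_imp_space_eq[OF sets] by simp
  have ev: "{y. P (y i)} \<in> events" for P i
    unfolding sets using open_coord_set by simp
  have "\<exists>n. prob {y. \<not> \<bar>y i\<bar> \<le> int n} \<le> (1 / 2) ^ (i + 2)" for i
  proof -
    let ?D = "\<lambda>n. {y::nat \<Rightarrow> int. \<not> \<bar>y i\<bar> \<le> int n}"
    have "(\<lambda>n. prob (?D n)) \<longlonglongrightarrow> prob (\<Inter>n. ?D n)"
    proof (rule finite_Lim_measure_decseq)
      show "range ?D \<subseteq> events"
        using ev[of "\<lambda>x. \<not> \<bar>x\<bar> \<le> int _" i] by blast
      show "decseq ?D"
        by (rule antimonoI) auto
    qed
    moreover have "(\<Inter>n. ?D n) = {}"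
    proof -
      have "x \<notin> ?D (nat \<bar>x i\<bar>)" for x
        by simp
      then show ?thesis
        by blast
    qed
    ultimately have "(\<lambda>n. prob (?D n)) \<longlonglongrightarrow> 0"
      by simp
    then have "eventually (\<lambda>n. prob (?D n) < (1 / 2) ^ (i + 2)) sequentially"
      by (rule order_tendstoD) simp
    then show ?thesis
      unfolding eventually_sequentially using less_imp_le by blast
  qed
  from choice[OF allI[OF this]] obtain b :: "nat \<Rightarrow> nat"
    where b: "\<forall>i. prob {y. \<not> \<bar>y i\<bar> \<le> int (b i)} \<le> (1 / 2) ^ (i + 2)" ..
  have "- {y. \<forall>i. \<bar>y i\<bar> \<le> int (b i)} = (\<Union>i. {y. \<not> \<bar>y i\<bar> \<le> int (b i)})"
    by auto
  then show ?thesis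
    using prob_UN_le_half[OF ev b[rule_format]] by (intro exI[of _ b]) simp
qed

text \<open>Fubini for the set of pairs \<open>(y, z)\<close> whose sum lies in \<open>B\<close>:
  its sections in the \<mu> direction are all null, hence so are almost all in the \<nu>
  direction.\<close>

lemma translate_null_ae:
  fixes \<mu> \<nu> :: "(nat \<Rightarrow> int) measure"
  assumes "prob_space \<mu>" and "prob_space \<nu>"
    and sets: "sets \<mu> = sets borel" "sets \<nu> = sets borel" and B: "B \<in> sets borel"
    and null: "\<And>z. measure \<mu> {y. (\<lambda>i. z i + y i) \<in> B} = 0"
  shows "AE y in \<mu>. measure \<nu> {z. (\<lambda>i. z i + y i) \<in> B} = 0"
proof -
  interpret M: prob_space \<mu> by fact
  interpret N: prob_space \<nu> by fact
  interpret pair_sigma_finite \<mu> \<nu> ..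
  have sp: "space \<mu> = UNIV" "space \<nu> = UNIV"
    using sets_eq_imp_space_eq[OF sets(1)] sets_eq_imp_space_eq[OF sets(2)] by simp_all
  let ?D = "{p. (\<lambda>i. snd p i + fst p i) \<in> B}"
  have "continuous_on UNIV (\<lambda>p::(nat \<Rightarrow> int) \<times> (nat \<Rightarrow> int). (\<lambda>i. snd p i + fst p i))"
  proof (rule continuous_on_coordinatewise_then_product)
    fix i
    have fst: "continuous_on UNIV (\<lambda>p::(nat \<Rightarrow> int) \<times> (nat \<Rightarrow> int). fst p i)"
      by (rule continuous_on_coord[OF continuous_on_fst[OF continuous_on_id]])
    have snd: "continuous_on UNIV (\<lambda>p::(nat \<Rightarrow> int) \<times> (nat \<Rightarrow> int). snd p i)"
      by (rule continuous_on_coord[OF continuous_on_snd[OF continuous_on_id]])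
    have "continuous_on UNIV (\<lambda>q::int \<times> int. snd q + fst q)"
    proof (rule continuous_on_open_vimage[THEN iffD2, rule_format])
      fix S :: "int set"
      have "(\<lambda>q. snd q + fst q) -` S \<inter> UNIV = (\<Union>a b. if b + a \<in> S then {a} \<times> {b} else {})"
        by (auto split: if_splits)
      moreover have op: "open (if b + a \<in> S then {a} \<times> {b} else {})" for a b
        by (cases "b + a \<in> S")
          (simp_all only: if_True if_False open_empty open_Times[OF Topological_Spaces.open_discrete Topological_Spaces.open_discrete])
      moreover have "open (\<Union>a b. if b + a \<in> S then {a} \<times> {b} else {})"
        by (intro open_UN ballI op)
      ultimately show "open ((\<lambda>q. snd q + fst q) -` S \<inter> UNIV)"
        by (simp only:)
    qed simp
    from continuous_on_compose2[OF this continuous_on_Pair[OF fst snd]]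
    show "continuous_on UNIV (\<lambda>p::(nat \<Rightarrow> int) \<times> (nat \<Rightarrow> int). snd p i + fst p i)"
      by simp
  qed
  from measurable_sets[OF borel_measurable_continuous_onI[OF this] B]
  have "?D \<in> sets borel"
    by (simp add: vimage_def)
  also have "sets (borel :: ((nat \<Rightarrow> int) \<times> (nat \<Rightarrow> int)) measure) = sets (\<mu> \<Otimes>\<^sub>M \<nu>)"
    unfolding borel_prod[symmetric] by (rule sets_pair_measure_cong) (simp_all add: sets)
  finally have D: "?D \<in> sets (\<mu> \<Otimes>\<^sub>M \<nu>)" .
  have "(\<integral>\<^sup>+ y. emeasure \<nu> (Pair y -` ?D) \<partial>\<mu>) = (\<integral>\<^sup>+ z. emeasure \<mu> ((\<lambda>y. (y, z)) -` ?D) \<partial>\<nu>)"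
    using N.emeasure_pair_measure_alt[OF D] emeasure_pair_measure_alt2[OF D] by simp
  also have "\<dots> = 0"
    using null by (simp add: vimage_def M.emeasure_eq_measure)
  finally have "AE y in \<mu>. emeasure \<nu> (Pair y -` ?D) = 0"
    by (subst (asm) nn_integral_0_iff_AE[OF N.measurable_emeasure_Pair[OF D]])
  then show ?thesis
    by (rule AE_mp) (rule AE_I2, simp add: vimage_def measure_def)
qed

text \<open>Some bounded \<open>y\<close> has a translate of \<open>B\<close> null for the block
  measure. The cyclic shift by \<open>y\<close> preserves that measure and equals translation by
  \<open>y\<close> outside an event of probability at most 1/2, so \<open>B\<close> has measure at
  most 1/2. A Borel hull is bounded because \<open>C\<close> itself may fail to be
  measurable.\<close>

lemma haar_null_imp_block_measure_less:
  assumes "haar_null C"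
  shows "\<exists>N B. B \<in> sets borel \<and> C \<subseteq> B \<and>
    (\<forall>\<alpha>. (\<forall>i. N i \<le> \<alpha> i) \<longrightarrow> measure (block_measure \<alpha>) B < 1)"
proof -
  obtain B :: "(nat \<Rightarrow> int) set" and \<mu> where B: "B \<in> sets borel" "C \<subseteq> B" and
    \<mu>: "prob_space \<mu>" "sets \<mu> = sets borel" and
    null: "\<forall>g h :: nat \<Rightarrow> int. measure \<mu> ((\<lambda>x i. g i + x i + h i) ` B) = 0"
    using assms unfolding haar_null_def by (elim exE conjE) rule
  interpret M: prob_space \<mu> by fact
  have sp: "space \<mu> = UNIV"
    using sets_eq_imp_space_eq[OF \<mu>(2)] by simp
  have null': "measure \<mu> {y. (\<lambda>i. z i + y i) \<in> B} = 0" for z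
  proof -
    have "(\<lambda>x i. - z i + x i + 0) ` B = {y. (\<lambda>i. z i + y i) \<in> B}"
    proof (intro set_eqI iffI)
      fix y assume "y \<in> {y. (\<lambda>i. z i + y i) \<in> B}"
      then show "y \<in> (\<lambda>x i. - z i + x i + 0) ` B"
        by (intro image_eqI[of _ _ "\<lambda>i. z i + y i"]) auto
    qed auto
    then show ?thesis
      using null[rule_format, of "\<lambda>i. - z i" "\<lambda>_. 0"] by simp
  qed
  obtain b :: "nat \<Rightarrow> nat" where b: "measure \<mu> (- {y. \<forall>i. \<bar>y i\<bar> \<le> int (b i)}) \<le> 1 / 2"
    using ex_box_positive_measure[OF \<mu>] ..
  \<comment> \<open>For \<alpha> above \<open>N\<close> the exit probability
    \<open>\<bar>y i\<bar> / 2 ^ \<alpha> i\<close> is at most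
    \<open>2 ^ b i / 2 ^ N i = (1 / 2) ^ (i + 2)\<close>. Only \<open>b\<close> enters
    \<open>N\<close>, since \<open>y\<close> is chosen after \<alpha>.\<close>
  define N where "N i = i + 2 + b i" for i
  have "measure (block_measure \<alpha>) B < 1" if \<alpha>: "\<forall>i. N i \<le> \<alpha> i" for \<alpha>
  proof -
    interpret P: prob_space "block_measure \<alpha>"
      unfolding block_measure_def by (rule prob_space_prod_pmf_measure)
    have sets: "P.events = sets borel"
      by (simp add: block_measure_def)
    have ae: "AE y in \<mu>. P.prob {z. (\<lambda>i. z i + y i) \<in> B} = 0"
      by (rule translate_null_ae[OF \<mu>(1) P.prob_space_axioms \<mu>(2) sets B(1) null'])
    \<comment> \<open>Almost every \<open>y\<close> gives a null translate, and the box given by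
      \<open>b\<close> has measure at least 1/2, so it contains such a \<open>y\<close>.\<close>
    obtain y where y: "\<And>i. \<bar>y i\<bar> \<le> int (b i)" and y_null: "P.prob {z. (\<lambda>i. z i + y i) \<in> B} = 0"
    proof (rule ccontr)
      assume "\<not> thesis"
      then have "AE y in \<mu>. y \<in> - {y. \<forall>i. \<bar>y i\<bar> \<le> int (b i)}"
        using ae that by (elim AE_mp) (rule AE_I2, blast)
      moreover have "- {y. \<forall>i. \<bar>y i\<bar> \<le> int (b i)} \<in> M.events"
      proof -
        have "- {y. \<forall>i. \<bar>y i\<bar> \<le> int (b i)} = (\<Union>i. {y. \<not> \<bar>y i\<bar> \<le> int (b i)})"
          by auto
        moreover have "open \<dots>"
          by (intro open_UN ballI open_coord_set)
        ultimately show ?thesis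
          unfolding \<mu>(2) by simp
      qed
      ultimately have "M.prob (- {y. \<forall>i. \<bar>y i\<bar> \<le> int (b i)}) = 1"
        by (subst M.prob_eq_1)
      then show False
        using b by simp
    qed
    define A where "A i = {z. z i \<notin> block (\<alpha> i) \<or> z i + y i \<notin> block (\<alpha> i)}" for i
    have A_ev: "A i \<in> P.events" for i
      unfolding sets A_def using open_coord_set by simp
    have A_le: "P.prob (A i) \<le> (1 / 2) ^ (i + 2)" for i
    proof -
      have "P.prob (A i) \<le> real_of_int \<bar>y i\<bar> / 2 ^ \<alpha> i"
        unfolding A_def block_measure_def
        using measure_prod_pmf_coord[of "\<lambda>i. pmf_of_set (block (\<alpha> i))" i
            "{x. x \<notin> block (\<alpha> i) \<or> x + y i \<notin> block (\<alpha> i)}"]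
          measure_block_exit_le[of "\<alpha> i" "y i"] by simp
      also have "\<dots> \<le> 2 ^ b i / 2 ^ N i"
      proof (rule frac_le)
        have "real_of_int \<bar>y i\<bar> \<le> real (b i)"
          using y[of i] by linarith
        also have "\<dots> \<le> 2 ^ b i"
          using of_nat_less_two_power less_imp_le by blast
        finally show "real_of_int \<bar>y i\<bar> \<le> 2 ^ b i" .
        show "(2::real) ^ N i \<le> 2 ^ \<alpha> i"
          using \<alpha> by (intro power_increasing) auto
      qed simp_all
      also have "\<dots> = (1 / 2) ^ (i + 2)"
        by (simp add: N_def power_add power_divide)
      finally show ?thesis .
    qed
    have T_ev: "{z. (\<lambda>i. z i + y i) \<in> B} \<in> P.events"
      using measurable_sets[OF measurable_coordwise[of "\<lambda>i x. x + y i" "\<lambda>i. pmf_of_set (block (\<alpha> i))"] B(1)]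
      by (simp add: vimage_def block_measure_def)
    let ?f = "\<lambda>i x. 4 ^ \<alpha> i + (x - 4 ^ \<alpha> i + y i) mod 2 ^ \<alpha> i"
    have "P.prob B = P.prob {z. (\<lambda>i. ?f i (z i)) \<in> B}"
      using measure_prod_pmf_vimage[OF B(1), of ?f "\<lambda>i. pmf_of_set (block (\<alpha> i))"]
      unfolding block_measure_def map_pmf_rotate_block .
    also have "\<dots> \<le> P.prob ((\<Union>i. A i) \<union> {z. (\<lambda>i. z i + y i) \<in> B})"
    proof (rule P.finite_measure_mono)
      show "{z. (\<lambda>i. ?f i (z i)) \<in> B} \<subseteq> (\<Union>i. A i) \<union> {z. (\<lambda>i. z i + y i) \<in> B}"
      proof (rule subsetI, rule UnCI)
        fix z assume z: "z \<in> {z. (\<lambda>i. ?f i (z i)) \<in> B}" "z \<notin> {z. (\<lambda>i. z i + y i) \<in> B}"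
        show "z \<in> (\<Union>i. A i)"
        proof (rule ccontr)
          assume "z \<notin> (\<Union>i. A i)"
          then have "z i + y i \<in> block (\<alpha> i)" for i
            by (simp add: A_def)
          then have "?f i (z i) = z i + y i" for i
            by (simp add: block_def algebra_simps)
          then show False
            using z by simp
        qed
      qed
    qed (use A_ev T_ev in auto)
    also have "\<dots> \<le> P.prob (\<Union>i. A i) + P.prob {z. (\<lambda>i. z i + y i) \<in> B}"
      by (rule measure_Un_le) (use A_ev T_ev in auto)
    also have "\<dots> \<le> 1 / 2"
      using P.prob_UN_le_half[OF A_ev A_le] y_null by simp
    finally show ?thesis
      by simp
  qed
  then show ?thesis
    using B by (intro exI[of _ N] exI[of _ B] conjI allI impI)
qed

section \<open>Selecting a point from a set of positive measure\<close>

text \<open>Dependent choice, one digit at a time. \<open>Pos k\<close> concerns the digits before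
  \<open>k\<close> and carries the recursion; \<open>H k\<close> also concerns digit
  \<open>k\<close> and is settled for good once that digit is set.\<close>

lemma ex_branch:
  assumes start: "Pos 0 d0"
    and step: "\<And>k d. Pos k d \<Longrightarrow> \<exists>p. Pos (Suc k) (d(k := p)) \<and> H k (d(k := p))"
    and Pos_cong: "\<And>k d d'. d' \<in> cylinder k d \<Longrightarrow> Pos k d \<Longrightarrow> Pos k d'"
    and H_cong: "\<And>k d d'. d' \<in> cylinder (Suc k) d \<Longrightarrow> H k d \<Longrightarrow> H k d'"
  shows "\<exists>d. \<forall>k. Pos k d \<and> H k d"
proof -
  define nxt where "nxt k d = (SOME p. Pos (Suc k) (d(k := p)) \<and> H k (d(k := p)))" for k d
  have nxt: "Pos (Suc k) (d(k := nxt k d)) \<and> H k (d(k := nxt k d))" if "Pos k d" for k d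
    unfolding nxt_def by (rule someI_ex[OF step[OF that]])
  define ds where "ds = rec_nat d0 (\<lambda>k d. d(k := nxt k d))"
  have ds_simps: "ds 0 = d0" "ds (Suc k) = (ds k)(k := nxt k (ds k))" for k
    by (simp_all add: ds_def)
  have Pos_ds: "Pos k (ds k)" for k
  proof (induction k)
    case (Suc k)
    then show ?case
      using nxt[of k "ds k"] by (simp only: ds_simps)
  qed (simp only: ds_simps start)
  \<comment> \<open>Digit \<open>k\<close> is set in passing to stage \<open>Suc k\<close> and never
    changed afterwards, so the diagonal agrees with \<open>ds k\<close> before
    \<open>k\<close>.\<close>
  define d where "d k = ds (Suc k) k" for k
  have "\<forall>i<k. ds k i = d i" for k
    by (induction k) (auto simp: ds_simps d_def less_Suc_eq)
  then have agree: "d \<in> cylinder k (ds k)" for k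
    by (simp add: cylinder_def)
  have "Pos k d" for k
    by (rule Pos_cong[OF agree Pos_ds])
  moreover have "H k d" for k
  proof (rule H_cong[OF agree])
    show "H k (ds (Suc k))"
      using nxt[OF Pos_ds[of k]] by (simp only: ds_simps)
  qed
  ultimately show ?thesis
    by blast
qed

text \<open>Given \<open>\<alpha>\<close>, a branch through Souslin schemes for the sets \<open>V n\<close> is chosen digit by digit.  A
  digit codes a triple: the next digit of the scheme, the next entry of the point, and a \<open>q\<close>
  certifying that the remaining set has measure at least \<open>1 / (q + 1)\<close>.  Thanks to \<open>q\<close>, ``\<open>p\<close> is
  the least admissible digit'' is a Boolean combination of sets of lower class.\<close>

lemma ex_selection:
  fixes V :: "nat \<Rightarrow> ((nat \<Rightarrow> nat) \<times> (nat \<Rightarrow> int)) set"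
  assumes wo: "Well_order r" and V: "\<And>n. \<exists>b\<in>Field r. pi0_below r b (V n)"
  shows "\<exists>A D. pi0_over r (Field r) A \<and> pi0_over r (Field r) D \<and>
    (\<forall>\<alpha>. \<alpha> \<in> D \<longleftrightarrow> (\<forall>n. measure (block_measure \<alpha>) {y. (\<alpha>, y) \<in> V n} = 0)) \<and>
    (\<forall>\<alpha>. \<alpha> \<notin> D \<longrightarrow> (\<exists>y. {y. (\<alpha>, y) \<in> A} = {y} \<and> (\<exists>n. (\<alpha>, y) \<in> V n) \<and> (\<forall>i. y i \<in> block (\<alpha> i))))"
proof -
  define lev where "lev n = (SOME b. b \<in> Field r \<and> pi0_below r b (V n))" for n
  have "lev n \<in> Field r \<and> pi0_below r (lev n) (V n)" for n
  proof -
    have "\<exists>b. b \<in> Field r \<and> pi0_below r b (V n)"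
      using V[of n] by blast
    then show ?thesis
      unfolding lev_def by (rule someI_ex)
  qed
  then have lev: "lev n \<in> Field r" and V_lev: "pi0_below r (lev n) (V n)" for n
    by simp_all
  define S where "S n = (SOME R. souslin_scheme r (lev n) (V n) R)" for n
  have S: "souslin_scheme r (lev n) (V n) (S n)" for n
    unfolding S_def by (rule someI_ex[OF ex_souslin_scheme[OF wo V_lev]])
  \<comment> \<open>Digit 0 picks the index of some \<open>V n\<close>; the remaining digits,
    shifted by one, run through the scheme of that set. Stage 0 is a union of sets of varying
    levels, so the class estimates start at \<open>Suc k\<close>.\<close>
  define R where "R k d = (if k = 0 then \<Union>n. V n else S (d 0) (k - 1) (\<lambda>i. d (Suc i)))"
    for k and d :: "nat \<Rightarrow> nat"
  have R_cong: "R k d' = R k d" if "d' \<in> cylinder k d" for k d d'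
  proof (cases k)
    case (Suc j)
    then have "d' 0 = d 0" "(\<lambda>i. d' (Suc i)) \<in> cylinder j (\<lambda>i. d (Suc i))"
      using that by (simp_all add: cylinder_def)
    then show ?thesis
      using souslin_schemeD(2)[OF S] by (simp add: R_def Suc)
  qed (simp add: R_def)
  have R_step: "\<exists>m. x \<in> R (Suc k) (d(k := m))" if x: "x \<in> R k d" for x k d
  proof (cases k)
    case 0
    then obtain n where "x \<in> V n"
      using x by (auto simp: R_def)
    moreover have "V n \<subseteq> S n 0 (\<lambda>i. d (Suc i))"
      by (rule souslin_schemeD(1)[OF S])
    ultimately show ?thesis
      by (intro exI[of _ n]) (auto simp: R_def 0)
  next
    case (Suc j)
    then have "x \<in> S (d 0) j (\<lambda>i. d (Suc i))"
      using x by (simp add: R_def)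
    then have "\<exists>m. x \<in> S (d 0) (Suc j) ((\<lambda>i. d (Suc i))(j := m))"
      by (rule souslin_schemeD(3)[OF S])
    then obtain m where "x \<in> S (d 0) (Suc j) ((\<lambda>i. d (Suc i))(j := m))" ..
    moreover have "(\<lambda>i. d (Suc i))(j := m) = (\<lambda>i. (d(Suc j := m)) (Suc i))"
      by auto
    ultimately show ?thesis
      by (intro exI[of _ m]) (simp add: R_def Suc)
  qed
  have R_below: "pi0_below r (lev (d 0)) (R (Suc k) d)" for k d
    unfolding R_def using souslin_schemeD(4)[OF S] by simp

  define dm where "dm p = fst (from_nat p :: nat \<times> int \<times> nat)" for p
  define dv where "dv p = fst (snd (from_nat p :: nat \<times> int \<times> nat))" for p
  define dq where "dq p = snd (snd (from_nat p :: nat \<times> int \<times> nat))" for p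
  define Q where "Q k d = R k (\<lambda>i. dm (d i)) \<inter> {(\<alpha>, z). \<forall>i<k. z i = dv (d i)}"
    for k and d :: "nat \<Rightarrow> nat"
  have Q_cong: "Q k d' = Q k d" if "\<forall>i<k. dm (d' i) = dm (d i) \<and> dv (d' i) = dv (d i)" for k d d'
  proof -
    have "R k (\<lambda>i. dm (d' i)) = R k (\<lambda>i. dm (d i))"
      by (rule R_cong) (use that in \<open>simp add: cylinder_def\<close>)
    then show ?thesis
      using that by (auto simp: Q_def)
  qed
  have Q_below: "pi0_below r (lev (dm (d 0))) (Q (Suc k) d)" for k d
  proof -
    have "{(\<alpha> :: nat \<Rightarrow> nat, z). \<forall>i<Suc k. z i = dv (d i)} = UNIV \<times> {z. \<forall>i<Suc k. z i = dv (d i)}"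
      by auto
    moreover have "closed {z. \<forall>i<Suc k. z i = dv (d i)}"
    proof -
      have "open (- {z :: nat \<Rightarrow> int. \<forall>i<Suc k. z i = dv (d i)})"
        by (rule open_finitely_determined[of _ "Suc k"]) (auto simp: cylinder_def)
      then show ?thesis
        by (simp add: closed_def)
    qed
    ultimately have "closed {(\<alpha> :: nat \<Rightarrow> nat, z). \<forall>i<Suc k. z i = dv (d i)}"
      by (simp only: closed_Times closed_UNIV)
    from closed_imp_pi0_below[OF wo this] show ?thesis
      unfolding Q_def by (intro pi0_below_Int[OF wo] R_below)
  qed

  define sec where "sec \<alpha> W = {y. (\<alpha>, y) \<in> W}" for \<alpha> and W :: "((nat \<Rightarrow> nat) \<times> (nat \<Rightarrow> int)) set"
  define M where "M k d = {\<alpha>. 1 / real (Suc (dq (d k))) \<le> measure (block_measure \<alpha>) (sec \<alpha> (Q (Suc k) d))}"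
    for k d
  have M_below: "pi0_below r (lev (dm (d 0))) (M k d)" for k d
    unfolding M_def sec_def block_measure_def by (rule pi0_below_measure_section_ge[OF wo Q_below])
  \<comment> \<open>\<open>M k d\<close> has a definite level in \<open>Field r\<close>, namely that
    of the set picked by digit 0, so both it and its complement lie in the class.\<close>
  have M_over: "pi0_over r (Field r) (M k d)" and M_over': "pi0_over r (Field r) (- M k d)" for k d
    by (rule pi0_below_imp_over[OF wo M_below lev Order_Relation.underS_Field],
        rule pi0_over_Compl_below[OF wo M_below lev])
  have M_cong: "M k d' = M k d" if "d' \<in> cylinder (Suc k) d" for k d d'
  proof -
    have "Q (Suc k) d' = Q (Suc k) d"
      by (rule Q_cong) (use that in \<open>simp add: cylinder_def\<close>)
    then show ?thesis
      using that by (simp add: M_def cylinder_def)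
  qed
  \<comment> \<open>Digit \<open>k\<close> is the least admissible one after its predecessors. Only
    finitely many smaller \<open>p\<close> are excluded, so \<open>- H k d\<close> is a finite union
    inside the class.\<close>
  define H where "H k d = M k d \<inter> - (\<Union>p<d k. M k (d(k := p)))" for k d
  have H_over: "pi0_over r (Field r) (- H k d)" for k d
  proof -
    have "- H k d = - M k d \<union> (\<Union>p\<in>{..<d k}. M k (d(k := p)))"
      by (auto simp: H_def)
    moreover have "pi0_over r (Field r) (\<Union>p\<in>{..<d k}. M k (d(k := p)))"
      by (rule pi0_over_finite_UN[OF wo _ subset_refl lev]) (simp_all add: M_over)
    ultimately show ?thesis
      using pi0_over_Un[OF wo subset_refl M_over'] by (simp only:)
  qed
  have H_cong: "H k d' = H k d" if "d' \<in> cylinder (Suc k) d" for k d d'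
  proof -
    have "M k (d'(k := p)) = M k (d(k := p))" for p
      by (rule M_cong) (use that in \<open>simp add: cylinder_def\<close>)
    moreover have "d' k = d k"
      using that by (simp add: cylinder_def)
    ultimately show ?thesis
      unfolding H_def M_cong[OF that] by simp
  qed
  \<comment> \<open>If two sequences agree before a position, their digits there are least elements
    of the same set.\<close>
  have H_unique: "d' \<in> cylinder k d" if "\<forall>i<k. \<alpha> \<in> H i d" "\<forall>i<k. \<alpha> \<in> H i d'" for \<alpha> k d d'
    using that
  proof (induction k)
    case 0
    then show ?case
      by (simp add: cylinder_def)
  next
    case (Suc k)
    then have IH: "d' \<in> cylinder k d"
      by simp
    have H: "\<alpha> \<in> H k d" "\<alpha> \<in> H k d'"
      using Suc.prems by simp_all
    have M1: "M k (d'(k := d k)) = M k d" "M k (d(k := d' k)) = M k d'"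
      by (rule M_cong, use IH in \<open>simp add: cylinder_def less_Suc_eq\<close>)+
    have "\<not> d k < d' k"
      using H M1(1) unfolding H_def by blast
    moreover have "\<not> d' k < d k"
      using H M1(2) unfolding H_def by blast
    ultimately show ?case
      using IH by (simp add: cylinder_def less_Suc_eq)
  qed

  \<comment> \<open>Finite lists stand for prefixes, which keeps the intersection in
    \<open>A\<close> countable; padding short lists by 0 is harmless because \<open>H_unique\<close>
    applies to every sequence.\<close>
  define nd where "nd ps i = (if i < length ps then ps ! i else 0)" for ps :: "nat list" and i
  \<comment> \<open>Read as an implication: if \<open>ps\<close> passes the tests for \<alpha> up to
    \<open>k\<close>, then \<open>y k\<close> is the entry recorded by its digit \<open>k\<close>.
    Quantifying universally over the prefixes gives an intersection where asking for a correct
    prefix would give a union.\<close>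
  define A where "A = (\<Inter>p. case p of (k, ps) \<Rightarrow>
      (\<Union>i\<in>{..k}. fst -` (- H i (nd ps))) \<union> {(\<alpha>, y). y k = dv (nd ps k)})"
  define D where "D = (\<Inter>p. case p of (n, j) \<Rightarrow>
      - {\<alpha>. 1 / real (Suc j) \<le> measure (block_measure \<alpha>) (sec \<alpha> (V n))})"
  have A_over: "pi0_over r (Field r) A"
    unfolding A_def
  proof (rule pi0_over_INT[OF wo])
    fix p :: "nat \<times> nat list"
    obtain k ps where p: "p = (k, ps)"
      by (rule prod.exhaust)
    have "pi0_over r (Field r) (fst -` (- H i (nd ps)) :: ((nat \<Rightarrow> nat) \<times> (nat \<Rightarrow> int)) set)" for i
      by (rule pi0_over_vimage[OF wo H_over continuous_on_fst[OF continuous_on_id]])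
    then have "pi0_over r (Field r) (\<Union>i\<in>{..k}. fst -` (- H i (nd ps)) :: ((nat \<Rightarrow> nat) \<times> (nat \<Rightarrow> int)) set)"
      by (intro pi0_over_finite_UN[OF wo _ subset_refl lev] ballI) simp_all
    moreover have "pi0_over r (Field r) {(\<alpha> :: nat \<Rightarrow> nat, y :: nat \<Rightarrow> int). y k = dv (nd ps k)}"
    proof -
      have "{(\<alpha> :: nat \<Rightarrow> nat, y :: nat \<Rightarrow> int). y k = dv (nd ps k)} = UNIV \<times> - {y. y k \<noteq> dv (nd ps k)}"
        by auto
      moreover have "closed \<dots>"
        by (rule closed_Times[OF closed_UNIV closed_Compl[OF open_coord_set[of "\<lambda>x. x \<noteq> dv (nd ps k)"]]])
      ultimately have "closed {(\<alpha> :: nat \<Rightarrow> nat, y :: nat \<Rightarrow> int). y k = dv (nd ps k)}"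
        by (simp only:)
      from pi0_below_imp_over[OF wo closed_imp_pi0_below[OF wo this] lev Order_Relation.underS_Field]
      show ?thesis .
    qed
    ultimately show "pi0_over r (Field r) (case p of (k, ps) \<Rightarrow>
        (\<Union>i\<in>{..k}. fst -` (- H i (nd ps))) \<union> {(\<alpha>, y). y k = dv (nd ps k)})"
      unfolding p prod.case by (rule pi0_over_Un[OF wo subset_refl])
  qed
  have D_over: "pi0_over r (Field r) D"
    unfolding D_def
  proof (rule pi0_over_INT[OF wo])
    fix p :: "nat \<times> nat"
    show "pi0_over r (Field r) (case p of (n, j) \<Rightarrow>
        - {\<alpha>. 1 / real (Suc j) \<le> measure (block_measure \<alpha>) (sec \<alpha> (V n))})"
      unfolding sec_def block_measure_def
      by (cases p) (simp only: prod.case,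
          rule pi0_over_Compl_below[OF wo pi0_below_measure_section_ge[OF wo V_lev] lev])
  qed
  have D_iff: "\<alpha> \<in> D \<longleftrightarrow> (\<forall>n. measure (block_measure \<alpha>) (sec \<alpha> (V n)) = 0)" for \<alpha>
  proof -
    have "measure (block_measure \<alpha>) X = 0 \<longleftrightarrow> (\<forall>j. \<not> 1 / real (Suc j) \<le> measure (block_measure \<alpha>) X)" for X
    proof
      show "measure (block_measure \<alpha>) X = 0" if "\<forall>j. \<not> 1 / real (Suc j) \<le> measure (block_measure \<alpha>) X"
      proof (rule ccontr)
        assume "measure (block_measure \<alpha>) X \<noteq> 0"
        then have "0 < measure (block_measure \<alpha>) X"
          using measure_nonneg[of "block_measure \<alpha>" X] by linarith
        then obtain j where "1 / real (Suc j) < measure (block_measure \<alpha>) X"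
          using nat_approx_posE by blast
        then show False
          using that less_imp_le by blast
      qed
    qed simp
    then show ?thesis
      by (simp add: D_def del: of_nat_Suc)
  qed
  have "\<exists>y. {y. (\<alpha>, y) \<in> A} = {y} \<and> (\<exists>n. (\<alpha>, y) \<in> V n) \<and> (\<forall>i. y i \<in> block (\<alpha> i))" if "\<alpha> \<notin> D" for \<alpha>
  proof -
    interpret prob_space "block_measure \<alpha>"
      unfolding block_measure_def by (rule prob_space_prod_pmf_measure)
    have ev: "events = sets borel"
      by (simp add: block_measure_def)
    have secV_ev: "sec \<alpha> (V n) \<in> events" for n
      unfolding ev sec_def by (rule measurable_section[OF wo V_lev])
    have secQ_ev: "sec \<alpha> (Q (Suc k) d) \<in> events" for k d
      unfolding ev sec_def by (rule measurable_section[OF wo Q_below])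
    define Pos where "Pos k d \<longleftrightarrow> 0 < prob (sec \<alpha> (Q k d))" for k d
    have "Pos 0 (\<lambda>_. 0)"
    proof -
      obtain n where "prob (sec \<alpha> (V n)) \<noteq> 0"
        using \<open>\<alpha> \<notin> D\<close> D_iff by blast
      then have "0 < prob (sec \<alpha> (V n))"
        using measure_nonneg[of "block_measure \<alpha>" "sec \<alpha> (V n)"] by linarith
      also have "\<dots> \<le> prob (\<Union>n. sec \<alpha> (V n))"
        by (rule finite_measure_mono) (use secV_ev in auto)
      also have "(\<Union>n. sec \<alpha> (V n)) = sec \<alpha> (Q 0 (\<lambda>_. 0))"
        by (auto simp: sec_def Q_def R_def)
      finally show ?thesis
        by (simp only: Pos_def)
    qed
    moreover have "\<exists>p. Pos (Suc k) (d(k := p)) \<and> \<alpha> \<in> H k (d(k := p))" if "Pos k d" for k d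
    proof -
      let ?T = "\<lambda>p. sec \<alpha> (Q (Suc k) (d(k := p)))"
      have sub: "sec \<alpha> (Q k d) \<subseteq> (\<Union>p. ?T p)"
      proof
        fix z assume z: "z \<in> sec \<alpha> (Q k d)"
        then have "(\<alpha>, z) \<in> R k (\<lambda>i. dm (d i))"
          by (simp add: sec_def Q_def)
        from R_step[OF this] obtain m where m: "(\<alpha>, z) \<in> R (Suc k) ((\<lambda>i. dm (d i))(k := m))" ..
        define p where "p = to_nat (m, z k, 0::nat)"
        have p: "dm p = m" "dv p = z k"
          by (simp_all add: dm_def dv_def p_def)
        have "(\<lambda>i. dm (d i))(k := m) = (\<lambda>i. dm ((d(k := p)) i))"
          by (auto simp: p)
        then have "z \<in> ?T p"
          using m z by (auto simp: sec_def Q_def p less_Suc_eq)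
        then show "z \<in> (\<Union>p. ?T p)"
          by blast
      qed
      have "\<exists>p. prob (?T p) \<noteq> 0"
      proof (rule ccontr)
        assume "\<not> (\<exists>p. prob (?T p) \<noteq> 0)"
        then have "?T p \<in> null_sets (block_measure \<alpha>)" for p
          using secQ_ev by (intro null_setsI) (simp_all add: emeasure_eq_measure)
        then have "(\<Union>p. ?T p) \<in> null_sets (block_measure \<alpha>)"
          by (rule null_sets_UN)
        then have "prob (\<Union>p. ?T p) = 0"
          by (rule measure_eq_0_null_sets)
        moreover have "prob (sec \<alpha> (Q k d)) \<le> prob (\<Union>p. ?T p)"
          by (rule finite_measure_mono[OF sub]) (use secQ_ev in auto)
        ultimately show False
          using \<open>Pos k d\<close> by (simp add: Pos_def)
      qed
      then obtain p0 where "prob (?T p0) \<noteq> 0" ..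
      then have "0 < prob (?T p0)"
        using measure_nonneg[of "block_measure \<alpha>" "?T p0"] by linarith
      then obtain q where q: "1 / real (Suc q) < prob (?T p0)"
        using nat_approx_posE by blast
      \<comment> \<open>\<open>Q\<close> does not read the third component, so replacing it by a
        suitable \<open>q\<close> makes the digit admissible without changing the remaining
        set.\<close>
      define p1 where "p1 = to_nat (dm p0, dv p0, q)"
      have p1: "dm p1 = dm p0" "dv p1 = dv p0" "dq p1 = q"
        by (simp_all add: dm_def dv_def dq_def p1_def)
      have "Q (Suc k) (d(k := p1)) = Q (Suc k) (d(k := p0))"
        by (rule Q_cong) (simp add: p1)
      then have "\<alpha> \<in> M k (d(k := p1))"
        using q by (simp add: M_def p1 del: of_nat_Suc)
      then have least: "\<alpha> \<in> M k (d(k := (LEAST p. \<alpha> \<in> M k (d(k := p)))))"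
        by (rule LeastI)
      define p where "p = (LEAST p. \<alpha> \<in> M k (d(k := p)))"
      have "\<alpha> \<in> M k (d(k := p))"
        using least unfolding p_def .
      moreover have "\<alpha> \<notin> M k (d(k := p'))" if "p' < p" for p'
        using not_less_Least that unfolding p_def by blast
      ultimately have "\<alpha> \<in> H k (d(k := p))"
        unfolding H_def by simp
      moreover have "Pos (Suc k) (d(k := p))"
        unfolding Pos_def
      proof (rule less_le_trans)
        show "1 / real (Suc (dq ((d(k := p)) k))) \<le> prob (?T p)"
          using \<open>\<alpha> \<in> M k (d(k := p))\<close> by (simp only: M_def mem_Collect_eq)
      qed simp
      ultimately show ?thesis
        by blast
    qed
    moreover have "Pos k d'" if "d' \<in> cylinder k d" "Pos k d" for k d d'
    proof -
      have "Q k d' = Q k d"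
        by (rule Q_cong) (use that(1) in \<open>simp add: cylinder_def\<close>)
      then show ?thesis
        using that(2) by (simp add: Pos_def)
    qed
    moreover have "\<alpha> \<in> H k d'" if "d' \<in> cylinder (Suc k) d" "\<alpha> \<in> H k d" for k d d'
      using H_cong[OF that(1)] that(2) by simp
    ultimately obtain d where d: "\<forall>k. Pos k d \<and> \<alpha> \<in> H k d"
      using ex_branch[of Pos "\<lambda>_. 0" "\<lambda>k d. \<alpha> \<in> H k d"] by blast
    define y where "y k = dv (d k)" for k
    have pos: "0 < prob (sec \<alpha> (Q k d))" for k
      using d unfolding Pos_def by blast
    have "{y. (\<alpha>, y) \<in> A} = {y}"
    proof (intro set_eqI iffI)
      fix y' assume y': "y' \<in> {y. (\<alpha>, y) \<in> A}"
      have "y' k = y k" for k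
      proof -
        let ?ps = "map d [0..<Suc k]"
        have nd: "nd ?ps i = d i" if "i \<le> k" for i
          using that by (simp add: nd_def nth_map del: upt_Suc)
        have "\<alpha> \<in> H i (nd ?ps)" if "i \<le> k" for i
        proof -
          have "nd ?ps \<in> cylinder (Suc i) d"
            using that nd by (simp add: cylinder_def del: upt_Suc)
          then show ?thesis
            using H_cong d by blast
        qed
        then show ?thesis
          using y' nd[of k] unfolding A_def y_def by (auto dest!: spec[of _ k] spec[of _ ?ps] simp del: upt_Suc)
      qed
      then show "y' \<in> {y}"
        by auto
    next
      fix y' assume "y' \<in> {y}"
      moreover have "(\<alpha>, y) \<in> (\<Union>i\<in>{..k}. fst -` (- H i (nd ps))) \<union> {(\<alpha>, y). y k = dv (nd ps k)}" for k ps
      proof (cases "\<forall>i<Suc k. \<alpha> \<in> H i (nd ps)")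
        case True
        then have "nd ps \<in> cylinder (Suc k) d"
          using d by (intro H_unique) simp_all
        then show ?thesis
          by (simp add: cylinder_def y_def)
      next
        case False
        then show ?thesis
          by (auto simp: less_Suc_eq_le)
      qed
      ultimately show "y' \<in> {y. (\<alpha>, y) \<in> A}"
        unfolding A_def by simp
    qed
    \<comment> \<open>Positive measure makes every stage nonempty, and its points share the first
      entries of \<open>y\<close>. The last clause of the scheme turns these approximations into
      membership of \<open>y\<close> itself.\<close>
    moreover have "(\<alpha>, y) \<in> V (dm (d 0))"
    proof (rule souslin_schemeD(5)[OF S])
      fix j
      have "sec \<alpha> (Q (Suc j) d) \<noteq> {}"
        using pos[of "Suc j"] by auto
      then obtain z where "(\<alpha>, z) \<in> Q (Suc j) d"
        by (auto simp: sec_def)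
      then show "\<exists>z\<in>cylinder j y. (\<alpha>, z) \<in> S (dm (d 0)) j (\<lambda>i. dm (d (Suc i)))"
        by (intro bexI[of _ z]) (simp_all add: Q_def R_def cylinder_def y_def)
    qed
    \<comment> \<open>If an entry of \<open>y\<close> left its block, the set of positive measure
      that fixes this entry would lie in a null set.\<close>
    moreover have "y i \<in> block (\<alpha> i)" for i
    proof (rule ccontr)
      assume "y i \<notin> block (\<alpha> i)"
      then have "sec \<alpha> (Q (Suc i) d) \<subseteq> {z. z i \<in> - block (\<alpha> i)}"
        by (auto simp: sec_def Q_def y_def)
      from finite_measure_mono[OF this]
      have "prob (sec \<alpha> (Q (Suc i) d)) \<le> prob {z. z i \<in> - block (\<alpha> i)}"
        using open_coord_set[of "\<lambda>x. x \<in> - block (\<alpha> i)" i] by (simp add: ev)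
      also have "\<dots> = 0"
        unfolding block_measure_def measure_prod_pmf_coord by (simp add: measure_pmf_of_set)
      finally show False
        using pos[of "Suc i"] by simp
    qed
    ultimately show ?thesis
      by (intro exI[of _ y]) blast
  qed
  then show ?thesis
    using A_over D_over D_iff unfolding sec_def by (intro exI[of _ A] exI[of _ D] conjI allI impI)
qed

section \<open>The Haar null set without small hull\<close>

text \<open>For \<open>k < l\<close> the lower block ends below
  \<open>4 ^ k + 2 ^ k \<le> 2 * 4 ^ k\<close>, while the upper one starts at
  \<open>4 ^ l \<ge> 4 * 4 ^ k\<close>.\<close>

lemma blocks_separated:
  assumes "x \<in> block k" "y \<in> block l" "k \<noteq> l"
  shows "2 \<le> \<bar>x - y\<bar>"
proof -
  have *: "2 \<le> y - x" if "x \<in> block k" "y \<in> block l" "k < l" for x y k l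
  proof -
    have "(2::int) ^ k \<le> 4 ^ k"
      by (rule power_mono) simp_all
    moreover have "(4::int) * 4 ^ k \<le> 4 ^ l"
      using power_increasing[of "Suc k" l "4::int"] \<open>k < l\<close> by simp
    moreover have "(1::int) \<le> 4 ^ k"
      by simp
    ultimately show ?thesis
      using that(1,2) unfolding block_def atLeastLessThan_iff by linarith
  qed
  show ?thesis
    using *[OF assms(1,2)] *[OF assms(2,1)] assms(3) by (cases "k < l") simp_all
qed

text \<open>Outside all blocks the value is arbitrary; inside, the blocks being disjoint makes it
  unique.\<close>

definition block_index :: "int \<Rightarrow> nat" where
  "block_index x = (SOME k. x \<in> block k)"

lemma block_index_eq: "x \<in> block k \<Longrightarrow> block_index x = k"
  unfolding block_index_def using blocks_separated[of x _ x k] by (intro some_equality) auto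

text \<open>Binary sequences differ by at most 1 in every coordinate, so apart from a null set
  \<open>S\<close> has at most one point, and the cylinders around it have measure
  \<open>(1 / 2) ^ k\<close>.\<close>

lemma binary_measure_eq_0:
  assumes unique: "\<And>x y. x \<in> S \<Longrightarrow> y \<in> S \<Longrightarrow> (\<And>i. \<bar>x i - y i\<bar> \<le> 1) \<Longrightarrow> x = y"
  shows "measure (prod_pmf_measure (\<lambda>_. pmf_of_set {0, 1})) S = 0"
proof -
  let ?\<tau> = "prod_pmf_measure (\<lambda>_. pmf_of_set {0, 1})"
  interpret prob_space ?\<tau>
    by (rule prob_space_prod_pmf_measure)
  let ?N = "\<Union>i. {z :: nat \<Rightarrow> int. z i \<in> - {0, 1}}"
  have "{z :: nat \<Rightarrow> int. z i \<in> - {0, 1}} \<in> null_sets ?\<tau>" for i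
  proof (rule null_setsI)
    show "emeasure ?\<tau> {z. z i \<in> - {0, 1}} = 0"
      unfolding emeasure_eq_measure measure_prod_pmf_coord by (simp add: measure_pmf_of_set)
    show "{z :: nat \<Rightarrow> int. z i \<in> - {0, 1}} \<in> events"
      using open_coord_set[of "\<lambda>x. x \<in> - {0, 1}" i] by simp
  qed
  then have N: "?N \<in> null_sets ?\<tau>"
    by (rule null_sets_UN)
  show ?thesis
  proof (cases "S \<subseteq> ?N")
    case True
    then have "prob S \<le> prob ?N"
      by (rule finite_measure_mono) (use N in auto)
    then show ?thesis
      using measure_eq_0_null_sets[OF N] measure_nonneg[of ?\<tau> S] by linarith
  next
    case False
    then obtain x where x: "x \<in> S" "\<And>i. x i \<in> {0, 1}"
      by auto
    have sub: "S \<subseteq> ?N \<union> cylinder k x" for k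
    proof
      fix y assume y: "y \<in> S"
      show "y \<in> ?N \<union> cylinder k x"
      proof (rule UnCI, rule ccontr)
        assume "y \<notin> ?N" "y \<notin> cylinder k x"
        have "\<bar>x i - y i\<bar> \<le> 1" for i
        proof -
          have "y i \<in> {0, 1}"
            using \<open>y \<notin> ?N\<close> by simp
          then show ?thesis
            using x(2)[of i] by auto
        qed
        from unique[OF x(1) y this] show False
          using \<open>y \<notin> cylinder k x\<close> by simp
      qed
    qed
    have cyl: "cylinder k x \<in> events" for k
      using open_cylinder[of k x] by simp
    have "prob (cylinder k x) = (1 / 2) ^ k" for k
    proof -
      have "cylinder k x = {z. \<forall>i\<in>{..<k}. z i \<in> {x i}}"
        by (auto simp: cylinder_def)
      then have "emeasure ?\<tau> (cylinder k x) = (\<Prod>i\<in>{..<k}. emeasure (measure_pmf (pmf_of_set {0, 1})) {x i})"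
        using emeasure_prod_pmf_box[of "{..<k}" "\<lambda>_. pmf_of_set {0, 1}" "\<lambda>i. {x i}"] by simp
      also have "\<dots> = (\<Prod>i\<in>{..<k}. ennreal (1 / 2))"
      proof (rule prod.cong[OF refl])
        fix i
        have "measure (pmf_of_set {0, 1}) {x i} = 1 / 2"
          using x(2)[of i] by (auto simp: measure_pmf_of_set)
        then show "emeasure (pmf_of_set {0, 1}) {x i} = ennreal (1 / 2)"
          by (simp only: measure_pmf.emeasure_eq_measure)
      qed
      also have "\<dots> = ennreal ((1 / 2) ^ k)"
        by (simp only: prod_constant card_lessThan ennreal_power)
      finally show ?thesis
        by (simp add: measure_def)
    qed
    moreover have "prob S \<le> prob (cylinder k x)" for k
    proof -
      have "prob S \<le> prob (?N \<union> cylinder k x)"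
        by (rule finite_measure_mono[OF sub]) (use N cyl in auto)
      also have "\<dots> \<le> prob ?N + prob (cylinder k x)"
        by (rule measure_Un_le) (use N cyl in auto)
      finally show ?thesis
        using measure_eq_0_null_sets[OF N] by simp
    qed
    ultimately have "\<forall>k. prob S \<le> (1 / 2) ^ k"
      by metis
    moreover have "(\<lambda>k. (1 / 2 :: real) ^ k) \<longlonglongrightarrow> 0"
      by (rule LIMSEQ_power_zero) simp
    ultimately have "prob S \<le> 0"
      by (intro LIMSEQ_le_const[of "\<lambda>k. (1 / 2) ^ k" 0]) auto
    then show ?thesis
      using measure_nonneg[of ?\<tau> S] by linarith
  qed
qed

text \<open>Translations preserve coordinate differences, so every translate of \<open>E\<close>
  inherits the hypothesis and is null for the uniform measure on binary sequences.\<close>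

lemma haar_nullI_separated:
  assumes "E \<in> sets borel"
    and "\<And>x y. x \<in> E \<Longrightarrow> y \<in> E \<Longrightarrow> (\<And>i. \<bar>x i - y i\<bar> \<le> 1) \<Longrightarrow> x = y"
  shows "haar_null E"
proof -
  have "measure (prod_pmf_measure (\<lambda>_. pmf_of_set {0, 1})) ((\<lambda>x i. g i + x i + h i) ` E) = 0" for g h
  proof (rule binary_measure_eq_0)
    fix x y assume "x \<in> (\<lambda>x i. g i + x i + h i) ` E" "y \<in> (\<lambda>x i. g i + x i + h i) ` E"
      and close: "\<And>i. \<bar>x i - y i\<bar> \<le> 1"
    then obtain x' y' where x': "x' \<in> E" "x = (\<lambda>i. g i + x' i + h i)"
      and y': "y' \<in> E" "y = (\<lambda>i. g i + y' i + h i)"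
      by blast
    have "\<bar>x' i - y' i\<bar> \<le> 1" for i
      using close[of i] by (simp add: x'(2) y'(2))
    from assms(2)[OF x'(1) y'(1) this] show "x = y"
      by (simp add: x'(2) y'(2))
  qed
  then show ?thesis
    unfolding haar_null_def using assms(1)
    by (intro exI[of _ E] exI[of _ "prod_pmf_measure (\<lambda>_. pmf_of_set {0, 1})"] conjI allI
        prob_space_prod_pmf_measure sets_prod_pmf_measure subset_refl)
qed

theorem theorem5p1:
  fixes r :: "nat rel"
  assumes "Well_order r" and "Field r \<noteq> {}"
  shows "\<exists>E :: zomega set. haar_null E \<and>
           (\<exists>A B :: zomega set. Pi0 r A \<and> Pi0 r B \<and> E = A - B) \<and>
           \<not> (\<exists>C :: zomega set. Pi0 r C \<and> haar_null C \<and> E \<subseteq> C)"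
proof -
  note wo = assms(1)
  obtain U :: "nat \<Rightarrow> ((nat \<Rightarrow> nat) \<times> zomega) set" where U: "(\<forall>n. \<exists>b\<in>Field r. pi0_below r b (U n)) \<and>
    (\<forall>F. (\<forall>n::nat. \<exists>b\<in>Field r. pi0_below r b (F n)) \<longrightarrow> (\<exists>\<beta>. (\<Union>n. {y. (\<beta>, y) \<in> U n}) = (\<Union>n. F n)))"
    using ex_universal_sequence[OF wo countableI_type assms(2) ex_universal_set[OF wo]] ..
  \<comment> \<open>Each \<open>\<alpha> m\<close> codes a pair: the first component is a digit of
    the parameter of the universal sequence, the second is free and lets \<alpha> grow.\<close>
  define dec :: "(nat \<Rightarrow> nat) \<Rightarrow> nat \<Rightarrow> nat" where "dec \<alpha> = (\<lambda>m. fst (prod_decode (\<alpha> m)))" for \<alpha>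
  \<comment> \<open>The sections of the \<open>V n\<close> at \<alpha> together form the complement
    of the set that \<alpha> codes.\<close>
  define V where "V n = (\<lambda>p. (dec (fst p), snd p)) -` U n" for n
  have cont: "continuous_on UNIV (\<lambda>p::(nat \<Rightarrow> nat) \<times> zomega. (dec (fst p), snd p))"
  proof (rule continuous_on_Pair[OF _ continuous_on_snd[OF continuous_on_id]])
    show "continuous_on UNIV (\<lambda>p::(nat \<Rightarrow> nat) \<times> zomega. dec (fst p))"
      unfolding dec_def
    proof (rule continuous_on_coordinatewise_then_product)
      fix m
      have "continuous_on UNIV (\<lambda>p::(nat \<Rightarrow> nat) \<times> zomega. fst p m)"
        by (rule continuous_on_coord[OF continuous_on_fst[OF continuous_on_id]])
      then show "continuous_on UNIV (\<lambda>p::(nat \<Rightarrow> nat) \<times> zomega. fst (prod_decode (fst p m)))"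
        by (rule continuous_on_compose_discrete)
    qed
  qed
  have V: "\<exists>b\<in>Field r. pi0_below r b (V n)" for n
  proof -
    obtain b where "b \<in> Field r" "pi0_below r b (U n)"
      using conjunct1[OF U, rule_format, of n] ..
    then show ?thesis
      unfolding V_def using pi0_below_vimage[OF wo _ cont] by (intro bexI[of _ b])
  qed
  obtain A D where A: "pi0_over r (Field r) A" and D: "pi0_over r (Field r) D"
    and D_iff: "\<forall>\<alpha>. \<alpha> \<in> D \<longleftrightarrow> (\<forall>n. measure (block_measure \<alpha>) {y. (\<alpha>, y) \<in> V n} = 0)"
    and sel: "\<forall>\<alpha>. \<alpha> \<notin> D \<longrightarrow> (\<exists>y. {y. (\<alpha>, y) \<in> A} = {y} \<and> (\<exists>n. (\<alpha>, y) \<in> V n) \<and> (\<forall>i. y i \<in> block (\<alpha> i)))"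
    using ex_selection[of r V, OF wo V] by (elim exE conjE) rule
  define al :: "zomega \<Rightarrow> nat \<Rightarrow> nat" where "al x = (\<lambda>i. block_index (x i))" for x
  have al_cont: "continuous_on UNIV al"
    unfolding al_def
  proof (rule continuous_on_coordinatewise_then_product)
    fix i
    show "continuous_on UNIV (\<lambda>x::zomega. block_index (x i))"
      by (rule continuous_on_compose_discrete[OF continuous_on_product_coordinates])
  qed
  \<comment> \<open>Discards the points lying in no box, where some value of
    \<open>block_index\<close> is arbitrary.\<close>
  define P :: "zomega set" where "P = {x. \<forall>i. x i \<in> block (al x i)}"
  define A' where "A' = P \<inter> (\<lambda>x. (al x, x)) -` A"
  \<comment> \<open>The points whose parameter codes a set of full block measure, so that nothing is
    selected.\<close>
  define B' where "B' = al -` D"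
  define E where "E = A' - B'"
  obtain b where b: "b \<in> Field r"
    using assms(2) by blast
  have "closed P"
  proof -
    have "- P = (\<Union>i. {x. x i \<notin> block (block_index (x i))})"
      by (auto simp: P_def al_def)
    moreover have "open \<dots>"
      by (intro open_UN ballI open_coord_set)
    ultimately show ?thesis
      by (simp add: closed_def)
  qed
  from pi0_below_imp_over[OF wo closed_imp_pi0_below[OF wo this] b Order_Relation.underS_Field]
  have "pi0_over r (Field r) P" .
  moreover have "pi0_over r (Field r) ((\<lambda>x. (al x, x)) -` A)"
    by (rule pi0_over_vimage[OF wo A continuous_on_Pair[OF al_cont continuous_on_id]])
  ultimately have A': "pi0_over r (Field r) A'"
    unfolding A'_def by (rule pi0_over_Int[OF wo])
  have B': "pi0_over r (Field r) B'"
    unfolding B'_def by (rule pi0_over_vimage[OF wo D al_cont])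
  have "haar_null E"
  proof (rule haar_nullI_separated)
    show "E \<in> sets borel"
      unfolding E_def by (intro sets.Diff pi0_over_borel[OF wo A'] pi0_over_borel[OF wo B'])
    fix x y assume xy: "x \<in> E" "y \<in> E" and close: "\<And>i. \<bar>x i - y i\<bar> \<le> 1"
    \<comment> \<open>Points at distance at most 1 in each coordinate lie in the same box, and a box
      contains at most one point of \<open>E\<close>.\<close>
    have "al x i = al y i" for i
    proof (rule ccontr)
      assume "al x i \<noteq> al y i"
      moreover have "x i \<in> block (al x i)" "y i \<in> block (al y i)"
        using xy by (simp_all add: E_def A'_def P_def)
      ultimately show False
        using blocks_separated close[of i] by fastforce
    qed
    then have "al x = al y"
      by auto
    then have "x \<in> {z. (al x, z) \<in> A}" "y \<in> {z. (al x, z) \<in> A}"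
      using xy by (simp_all add: E_def A'_def)
    moreover have "al x \<notin> D"
      using xy(1) by (simp add: E_def B'_def)
    then obtain z where z: "{y. (al x, y) \<in> A} = {z}"
      using sel by blast
    ultimately show "x = y"
      unfolding z by simp
  qed
  moreover have "\<not> (pi0_over r (Field r) C \<and> haar_null C \<and> E \<subseteq> C)" for C :: "zomega set"
  proof
    assume "pi0_over r (Field r) C \<and> haar_null C \<and> E \<subseteq> C"
    then have C: "pi0_over r (Field r) C" "haar_null C" "E \<subseteq> C"
      by simp_all
    obtain F where F: "(\<forall>n::nat. \<exists>b\<in>Field r. pi0_below r b (F n)) \<and> C = - (\<Union>n. F n)"
      using C(1) unfolding pi0_over_def ..
    obtain \<beta> where \<beta>: "(\<Union>n. {y. (\<beta>, y) \<in> U n}) = (\<Union>n. F n)"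
      using conjunct2[OF U, rule_format, OF conjunct1[OF F, rule_format]] ..
    obtain N B where B: "B \<in> sets borel" "C \<subseteq> B"
      and less_1: "\<forall>\<alpha>. (\<forall>i. N i \<le> \<alpha> i) \<longrightarrow> measure (block_measure \<alpha>) B < 1"
      using haar_null_imp_block_measure_less[OF C(2)] by (elim exE conjE) rule
    \<comment> \<open>This \<alpha> codes \<open>C\<close> through \<beta>, and it dominates
      \<open>N\<close> because a pair code is at least its second component.\<close>
    define \<alpha> where "\<alpha> m = prod_encode (\<beta> m, N m)" for m
    have "dec \<alpha> = \<beta>"
      by (simp add: dec_def \<alpha>_def)
    then have VF: "(\<Union>n. {y. (\<alpha>, y) \<in> V n}) = - C"
      using \<beta> F by (simp add: V_def)
    interpret prob_space "block_measure \<alpha>"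
      unfolding block_measure_def by (rule prob_space_prod_pmf_measure)
    have ev: "events = sets borel" "space (block_measure \<alpha>) = UNIV"
      by (simp_all add: block_measure_def)
    have V_ev: "{y. (\<alpha>, y) \<in> V n} \<in> events" for n
    proof -
      obtain b where "pi0_below r b (V n)"
        using V[of n] ..
      then show ?thesis
        unfolding ev by (rule measurable_section[OF wo])
    qed
    \<comment> \<open>Otherwise \<open>- C\<close>, and with it \<open>- B\<close>, would be null,
      against the bound on the block measure of \<open>B\<close>.\<close>
    have "\<alpha> \<notin> D"
    proof
      assume "\<alpha> \<in> D"
      then have "{y. (\<alpha>, y) \<in> V n} \<in> null_sets (block_measure \<alpha>)" for n
        using D_iff V_ev by (intro null_setsI) (simp_all add: emeasure_eq_measure)
      then have "- C \<in> null_sets (block_measure \<alpha>)"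
        unfolding VF[symmetric] by (rule null_sets_UN)
      moreover have "- B \<subseteq> - C" "- B \<in> events"
        using B unfolding ev by (simp_all add: borel_comp)
      ultimately have "- B \<in> null_sets (block_measure \<alpha>)"
        by (metis null_sets_subset)
      then have "prob (space (block_measure \<alpha>) - B) = 0"
        using measure_eq_0_null_sets by (simp add: ev(2) Compl_eq_Diff_UNIV)
      moreover have "prob B < 1"
        using less_1 le_prod_encode_2 by (simp add: \<alpha>_def)
      ultimately show False
        using prob_compl[of B] B(1) ev(1) by simp
    qed
    \<comment> \<open>The point selected for \<alpha> avoids \<open>C\<close>, yet it belongs to
      \<open>E\<close>, since \<open>al\<close> recovers \<alpha> from it.\<close>
    then obtain y where y: "{y. (\<alpha>, y) \<in> A} = {y}" "\<exists>n. (\<alpha>, y) \<in> V n" "\<forall>i. y i \<in> block (\<alpha> i)"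
      using sel by blast
    have "al y = \<alpha>"
      using y(3) block_index_eq unfolding al_def by blast
    moreover have "(\<alpha>, y) \<in> A"
      using y(1) by blast
    ultimately have "y \<in> E"
      using y(3) \<open>\<alpha> \<notin> D\<close> by (simp add: E_def A'_def B'_def P_def)
    moreover have "y \<in> - C"
      using y(2) unfolding VF[symmetric] by blast
    ultimately show False
      using C(3) by blast
  qed
  ultimately show ?thesis
    unfolding Pi0_eq_over using A' B' E_def by (intro exI[of _ E] conjI exI[of _ A'] exI[of _ B']) simp_all
qed

end
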